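(* Let $\mu_c$ (for real $c<-2$ sufficiently close to $-2$) be the probability measure on $\mathbb{C}$ which assigns equal mass to each zero of $D_c$ of modulus less than $1000$, zeros counted with multiplicity. Then, as $c\to-2$ with $c<-2$, the measures $\mu_c$ converge weakly to the uniform probability distribution (normalized arc length) on the circle $\{\lambda\in\mathbb{C}:|\lambda|=4\}$.
   Context: For real $c<-2$ let $f_c(z)=z^2+c$, and let $r_n(c)=f_c^{\circ n}(0)$ denote the $n$-th iterate of $f_c$ at $0$; thus $r_1(c)=c$ and $r_{n+1}(c)=r_n(c)^2+c$. Define the entire function $D_c(\lambda)=1+\sum_{n=1}^{\infty}\frac{\lambda^n}{2^n r_1(c)r_2(c)\cdots r_n(c)}$. For $c<-2$ close to $-2$ the function $D_c$ has at least one zero of modulus less than $1000$, so $\mu_c$ is well defined. *)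

theory Defs
  imports "HOL-Analysis.Analysis"
begin

fun orbit_r :: "real \<Rightarrow> nat \<Rightarrow> real" where
  "orbit_r c 0 = 0"
| "orbit_r c (Suc n) = (orbit_r c n)^2 + c"

definition D :: "real \<Rightarrow> complex \<Rightarrow> complex" where
  "D c w = 1 + (\<Sum>n. w ^ (Suc n) /
       complex_of_real (2 ^ (Suc n) * (\<Prod>k\<in>{1..Suc n}. orbit_r c k)))"

definition zero_mult :: "(complex \<Rightarrow> complex) \<Rightarrow> complex \<Rightarrow> nat" where
  "zero_mult f z = (LEAST n. (deriv ^^ n) f z \<noteq> 0)"

definition small_zeros :: "real \<Rightarrow> complex set" where
  "small_zeros c = {z. norm z < 1000 \<and> D c z = 0}"

definition mu_integral :: "real \<Rightarrow> (complex \<Rightarrow> real) \<Rightarrow> real" where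
  "mu_integral c g =
     (\<Sum>z\<in>small_zeros c. real (zero_mult (D c) z) * g z) /
     (\<Sum>z\<in>small_zeros c. real (zero_mult (D c) z))"

end

theory Submission
  imports Defs "HOL-Complex_Analysis.Complex_Analysis" "HOL-Real_Asymp.Real_Asymp"
begin

text \<open>
  The orbit stays near modulus \<open>2\<close> for a number of steps tending to infinity as \<open>c\<close> tends to \<open>-2\<close>
  and then escapes doubly exponentially. If \<open>n\<close> is the first index with \<open>|r_n(c)| \<ge> 1000\<close> and
  \<open>R = 20 |r_n(c)|\<close>, the \<open>n\<close>-th term of the series dominates \<open>D_c\<close> on the annulus
  \<open>R \<le> |z| < 3R\<close>. Dividing \<open>D_c\<close> by its Blaschke products on the discs of radius \<open>R\<close> and \<open>2R\<close>
  gives zero-free functions of almost constant modulus. Comparing their values at \<open>0\<close> shows that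
  the number \<open>N\<close> of zeros in \<open>|z| < R\<close> differs from \<open>n\<close> by at most \<open>2\<close> and that the sum of
  \<open>ln (|z| / 4)\<close> over the zeros is bounded above. Comparing the Taylor coefficients of the
  logarithms of the two quotients bounds every power sum of the zeros independently of \<open>c\<close>.
  Since \<open>|D_c(z)| \<le> 4 / (4 - |z|)\<close> for \<open>|z| < 4\<close>, Jensen's inequality controls the zeros inside
  \<open>|z| = 4\<close>, so the sum of \<open>|ln (|z| / 4)|\<close> is \<open>o(N)\<close>: all but \<open>o(N)\<close> of the zeros lie close
  to the circle. On the circle every polynomial in \<open>z\<close> and \<open>cnj z\<close> is a combination of powers of
  \<open>z\<close> and of \<open>cnj z\<close>, whose averages over the zeros tend to \<open>0\<close>, and the
  Stone--Weierstrass theorem finishes the proof.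
\<close>

subsection \<open>The escaping orbit and the dominant term\<close>

text \<open>Only the first value r_1(c) = c is negative, so the moduli obey the same recursion from
  -c on; dropping r_0 = 0 shifts the index by one.\<close>

definition orbit_abs :: "real \<Rightarrow> nat \<Rightarrow> real" where
  "orbit_abs c n = \<bar>orbit_r c (Suc n)\<bar>"

lemma orbit_abs_0: "c < -2 \<Longrightarrow> orbit_abs c 0 = -c"
  by (simp add: orbit_abs_def)

text \<open>The half-line from -c upwards is invariant, since c^2 + c exceeds -c by c (c + 2); the
  orbit enters it at c^2 + c.\<close>

lemma orbit_r_Suc_Suc_pos:
  assumes "c < -2" shows "orbit_r c (Suc (Suc n)) \<ge> -c"
proof (induction n)
  case 0
  have "c * (c + 2) \<ge> 0" using assms by (intro mult_nonpos_nonpos) auto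
  then show ?case by (simp add: power2_eq_square algebra_simps)
next
  case (Suc n)
  have "orbit_r c (Suc (Suc n)) ^ 2 \<ge> (-c)^2"
    using Suc assms by (intro power_mono) auto
  moreover have "c * (c + 2) \<ge> 0" using assms by (intro mult_nonpos_nonpos) auto
  ultimately show ?case by (simp add: power2_eq_square algebra_simps)
qed

lemma orbit_abs_Suc:
  assumes "c < -2" shows "orbit_abs c (Suc n) = orbit_abs c n ^ 2 + c"
  using orbit_r_Suc_Suc_pos[OF assms, of n] assms by (simp add: orbit_abs_def)

lemma orbit_abs_ge:
  assumes "c < -2" shows "orbit_abs c n \<ge> -c"
proof (cases n)
  case (Suc k)
  then show ?thesis using orbit_r_Suc_Suc_pos[OF assms, of k] assms unfolding orbit_abs_def Suc by simp
qed (use assms in \<open>simp add: orbit_abs_def\<close>)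

text \<open>At c = -2 the point 2 is a repelling fixed point of multiplier 4. If d is the excess
  over 2, the next excess is d^2 + 4 d + (c + 2); as d is at least -(c + 2), one of the four copies
  of d absorbs c + 2.\<close>

lemma orbit_excess_Suc:
  assumes "c < -2" shows "orbit_abs c (Suc n) - 2 \<ge> 3 * (orbit_abs c n - 2)"
proof -
  define d where "d = orbit_abs c n - 2"
  have d: "d \<ge> -c - 2" using orbit_abs_ge[OF assms, of n] by (simp add: d_def)
  have "orbit_abs c n = d + 2" by (simp add: d_def)
  then have "orbit_abs c (Suc n) - 2 = d * d + 4 * d + 4 + c - 2"
    by (simp add: orbit_abs_Suc[OF assms] power2_eq_square algebra_simps)
  then show ?thesis using d assms zero_le_square[of d] unfolding d_def[symmetric] by argo
qed

lemma orbit_abs_mono: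
  assumes "c < -2" "i \<le> j" shows "orbit_abs c i \<le> orbit_abs c j"
proof (rule lift_Suc_mono_le[OF _ assms(2)])
  show "orbit_abs c n \<le> orbit_abs c (Suc n)" for n
    using orbit_excess_Suc[OF assms(1), of n] orbit_abs_ge[OF assms(1), of n] assms(1) by simp
qed

lemma orbit_excess_ge:
  assumes "c < -2" shows "orbit_abs c n - 2 \<ge> 3 ^ n * (-c - 2)"
proof (induction n)
  case (Suc n)
  then show ?case using orbit_excess_Suc[OF assms, of n] by simp
qed (use orbit_abs_0 assms in simp)

lemma orbit_abs_at_top:
  assumes "c < -2" shows "filterlim (orbit_abs c) at_top sequentially"
proof (rule filterlim_at_top_mono)
  show "filterlim (\<lambda>n. 3 ^ n * (-c - 2) :: real) at_top sequentially"
    using assms by real_asymp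
  show "\<forall>\<^sub>F n in sequentially. 3 ^ n * (-c - 2) \<le> orbit_abs c n"
    using orbit_excess_ge[OF assms] by (intro always_eventually allI) (smt (verit))
qed

text \<open>Each excess is at most a third of the next, and 1 + 1/3 + 1/9 + ... = 3/2.\<close>

lemma sum_orbit_excess_le:
  assumes "c < -2" shows "(\<Sum>k\<le>n. orbit_abs c k - 2) \<le> 3 / 2 * (orbit_abs c n - 2)"
proof (induction n)
  case 0
  then show ?case using orbit_abs_ge[OF assms, of 0] assms by simp
next
  case (Suc n)
  then show ?case using orbit_excess_Suc[OF assms, of n] by simp
qed

lemma orbit_abs_tendsto_2: "((\<lambda>c. orbit_abs c n) \<longlongrightarrow> 2) (at_left (-2))"
proof -
  \<comment> \<open>At c = -2 the orbit is -2, 2, 2, ...; recording only the modulus of the limit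
    lets one induction cover the change of sign.\<close>
  have r: "\<exists>L. ((\<lambda>c. orbit_r c (Suc n)) \<longlongrightarrow> L) (at_left (-2)) \<and> \<bar>L\<bar> = 2 " for n
  proof (induction n)
    case 0
    show ?case by (rule exI[of _ "-2"]) (auto intro!: tendsto_eq_intros)
  next
    case (Suc n)
    then obtain L where L: "((\<lambda>c. orbit_r c (Suc n)) \<longlongrightarrow> L) (at_left (-2))" "\<bar>L\<bar> = 2" by blast
    have "((\<lambda>c. orbit_r c (Suc n) ^ 2 + c) \<longlongrightarrow> L ^ 2 + (-2)) (at_left (-2))"
      by (intro tendsto_intros L)
    moreover have "L ^ 2 = 4" using power2_abs[of L] by (simp add: L(2))
    ultimately show ?case by (intro exI[of _ 2]) auto
  qed
  then obtain L where L: "((\<lambda>c. orbit_r c (Suc n)) \<longlongrightarrow> L) (at_left (-2))" "\<bar>L\<bar> = 2"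
    by blast
  show ?thesis
    using tendsto_rabs[OF L(1)] L(2) by (simp add: orbit_abs_def)
qed

section \<open>Size of the Taylor coefficients\<close>

definition D_coeff :: "real \<Rightarrow> nat \<Rightarrow> real" where
  "D_coeff c n = 1 / (2 ^ n * (\<Prod>k\<in>{1..n}. orbit_r c k))"

lemma abs_D_coeff: "\<bar>D_coeff c n\<bar> = (\<Prod>k<n. 1 / (2 * orbit_abs c k))"
proof -
  have "(\<Prod>k\<in>{1..n}. \<bar>orbit_r c k\<bar>) = (\<Prod>k<n. orbit_abs c k)"
    by (simp add: orbit_abs_def prod.atLeast1_atMost_eq)
  then show ?thesis
    by (simp add: D_coeff_def abs_mult abs_prod prod_dividef prod.distrib)
qed

lemma abs_D_coeff_Suc: "\<bar>D_coeff c (Suc n)\<bar> = \<bar>D_coeff c n\<bar> / (2 * orbit_abs c n)"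
  by (simp add: abs_D_coeff)

lemma abs_D_coeff_pos: "c < -2 \<Longrightarrow> \<bar>D_coeff c n\<bar> > 0"
  unfolding abs_D_coeff
proof (intro prod_pos ballI)
  fix k assume "c < -2"
  then show "0 < 1 / (2 * orbit_abs c k)" using orbit_abs_ge[of c k] by simp
qed

lemma abs_D_coeff_le:
  assumes "c < -2" shows "\<bar>D_coeff c n\<bar> \<le> 1 / 4 ^ n"
proof -
  have "(\<Prod>k<n. 1 / (2 * orbit_abs c k)) \<le> (\<Prod>k<n. 1 / 4)"
  proof (rule prod_mono)
    fix k show "0 \<le> 1 / (2 * orbit_abs c k) \<and> 1 / (2 * orbit_abs c k) \<le> 1 / 4"
      using orbit_abs_ge[OF assms, of k] assms by (auto simp: field_simps)
  qed
  then show ?thesis by (simp add: abs_D_coeff power_one_over)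
qed

text \<open>The bound x / 2 \<le> exp ((x - 2) / 2) turns the product into the exponential of half
  the sum of the excesses, which is at most 3/4 of the last excess. So the deviation from 4^-n is
  controlled by the last orbit value alone, however large n is.\<close>

lemma abs_D_coeff_ge:
  assumes "c < -2" shows "\<bar>D_coeff c (Suc n)\<bar> \<ge> exp (- orbit_abs c n) / 4 ^ Suc n"
proof -
  have "1 / (2 * orbit_abs c k) \<ge> exp (- ((orbit_abs c k - 2) / 2)) / 4" for k
  proof -
    have "orbit_abs c k / 2 \<le> exp ((orbit_abs c k - 2) / 2)"
      using exp_ge_add_one_self[of "(orbit_abs c k - 2) / 2"] by (simp add: field_simps)
    then show ?thesis using orbit_abs_ge[OF assms, of k] assms
      by (simp add: exp_minus field_simps)
  qed
  then have "(\<Prod>k\<le>n. exp (- ((orbit_abs c k - 2) / 2)) / 4) \<le> (\<Prod>k\<le>n. 1 / (2 * orbit_abs c k))"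
    by (intro prod_mono) auto
  also have "(\<Prod>k\<le>n. exp (- ((orbit_abs c k - 2) / 2)) / 4)
      = exp (- ((\<Sum>k\<le>n. orbit_abs c k - 2) / 2)) / 4 ^ Suc n"
    by (simp add: prod_dividef exp_sum[symmetric] sum_negf sum_divide_distrib[symmetric])
  finally have "\<bar>D_coeff c (Suc n)\<bar> \<ge> exp (- ((\<Sum>k\<le>n. orbit_abs c k - 2) / 2)) / 4 ^ Suc n"
    by (simp add: abs_D_coeff lessThan_Suc_atMost)
  moreover have "exp (- ((\<Sum>k\<le>n. orbit_abs c k - 2) / 2)) \<ge> exp (- orbit_abs c n)"
    using sum_orbit_excess_le[OF assms, of n] orbit_abs_ge[OF assms, of n] assms by simp
  ultimately show ?thesis
    by (smt (verit) divide_right_mono zero_le_power)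
qed

lemma summable_D:
  fixes w :: complex
  assumes "c < -2" shows "summable (\<lambda>n. norm (of_real (D_coeff c n) * w ^ n))"
proof -
  obtain M where M: "\<And>n. n \<ge> M \<Longrightarrow> orbit_abs c n \<ge> norm w"
    using orbit_abs_at_top[OF assms] unfolding filterlim_at_top eventually_sequentially by blast
  show ?thesis
  proof (rule summable_ratio_test[where c = "1/2" and N = M])
    fix n assume n: "n \<ge> M"
    have "orbit_abs c n > 0" using orbit_abs_ge[OF assms, of n] assms by simp
    then have "\<bar>D_coeff c n\<bar> * norm w ^ n * (norm w / (2 * orbit_abs c n)) \<le> \<bar>D_coeff c n\<bar> * norm w ^ n * (1 / 2)"
      using M[OF n] by (intro mult_left_mono) (auto simp: field_simps)
    then show "norm (norm (of_real (D_coeff c (Suc n)) * w ^ Suc n))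
        \<le> 1 / 2 * norm (norm (of_real (D_coeff c n) * w ^ n))"
      using \<open>orbit_abs c n > 0\<close>
      by (simp add: norm_mult norm_power abs_D_coeff_Suc abs_of_pos mult_ac)
  qed simp
qed

lemma D_sums:
  assumes "c < -2" shows "(\<lambda>n. of_real (D_coeff c n) * w ^ n) sums D c w"
proof -
  have s: "summable (\<lambda>n. of_real (D_coeff c n) * w ^ n)"
    using summable_D[OF assms] by (rule summable_norm_cancel)
  have "(\<Sum>n. of_real (D_coeff c n) * w ^ n) = D c w"
    using suminf_split_head[OF s] by (simp add: D_def D_coeff_def)
  then show ?thesis using s by (simp add: sums_iff)
qed

lemma D_0: "c < -2 \<Longrightarrow> D c 0 = 1"
  by (simp add: D_def)

lemma D_holomorphic: assumes "c < -2" shows "D c holomorphic_on S"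
proof -
  have "D c holomorphic_on ball 0 (norm z + 1)" for z :: complex
    using D_sums[OF assms] by (intro power_series_holomorphic) auto
  then have "D c field_differentiable at z" for z
    by (rule holomorphic_on_imp_differentiable_at[where s = "ball 0 (norm z + 1)"]) auto
  then show ?thesis by (simp add: holomorphic_on_def field_differentiable_at_within)
qed

text \<open>Comparison with a geometric series. The bound is independent of c, which is what makes
  Jensen's inequality effective inside the circle of radius 4.\<close>

lemma norm_D_le:
  assumes "c < -2" "norm w < 4" shows "norm (D c w) \<le> 4 / (4 - norm w)"
proof -
  have "norm (of_real (D_coeff c n) * w ^ n) \<le> (norm w / 4) ^ n" for n
    using mult_right_mono[OF abs_D_coeff_le[OF assms(1), of n], of "norm w ^ n"]
    by (simp add: norm_mult norm_power power_divide)
  moreover have g: "(\<lambda>n. (norm w / 4) ^ n) sums (1 / (1 - norm w / 4))"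
    using assms by (intro geometric_sums) auto
  ultimately have "norm (D c w) \<le> 1 / (1 - norm w / 4)"
    using norm_sums_le[OF D_sums[OF assms(1)] g] by blast
  then show ?thesis using assms by (simp add: field_simps)
qed

text \<open>Both flanks of the peak are geometric with ratio 1/10, so each adds up to at most 1/9 of
  the peak, and 2/9 is below 1/2.\<close>

lemma unimodal_series_dominant:
  fixes f :: "nat \<Rightarrow> 'a :: banach"
  assumes f: "summable (\<lambda>k. norm (f k))"
    and up: "\<And>k. k < n \<Longrightarrow> 10 * norm (f k) \<le> norm (f (Suc k))"
    and down: "\<And>k. k \<ge> n \<Longrightarrow> 10 * norm (f (Suc k)) \<le> norm (f k)"
  shows "norm (suminf f - f n) \<le> norm (f n) / 2"
proof -
  have init: "k \<le> n \<Longrightarrow> (\<Sum>i<k. norm (f i)) \<le> norm (f k) / 9" for k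
  proof (induction k)
    case (Suc k)
    then show ?case using up[of k] by simp
  qed simp
  have dec: "norm (f (n + k)) \<le> norm (f n) * (1 / 10) ^ k" for k
  proof (induction k)
    case (Suc k)
    then show ?case using down[of "n + k"] by simp
  qed simp
  define t where "t = (\<lambda>k. f (k + Suc n))"
  have t: "norm (t k) \<le> norm (f n) / 10 * (1 / 10) ^ k" for k
    using dec[of "Suc k"] by (simp add: t_def add_ac)
  have "(\<lambda>k. norm (f n) / 10 * (1 / 10) ^ k) sums (norm (f n) / 10 * (1 / (1 - 1 / 10)))"
    by (intro sums_mult geometric_sums) auto
  moreover have st: "summable t"
    unfolding t_def using summable_ignore_initial_segment[OF f, of "Suc n"]
    by (intro summable_norm_cancel[of "\<lambda>k. f (k + Suc n)"]) simp
  ultimately have tail: "norm (suminf t) \<le> norm (f n) / 10 * (1 / (1 - 1 / 10))"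
    using t by (intro norm_sums_le[OF summable_sums]) auto
  have "suminf f = suminf t + sum f {..<Suc n}"
    unfolding t_def by (rule suminf_split_initial_segment) (rule summable_norm_cancel[OF f])
  then have "suminf f - f n = suminf t + sum f {..<n}" by simp
  also have "norm \<dots> \<le> norm (suminf t) + (\<Sum>i<n. norm (f i))"
    by (intro norm_triangle_le add_mono order_refl norm_sum)
  also have "\<dots> \<le> norm (f n) / 10 * (1 / (1 - 1 / 10)) + norm (f n) / 9"
    using tail init[of n] by simp
  also have "\<dots> \<le> norm (f n) / 2" by simp
  finally show ?thesis .
qed

text \<open>Indices are shifted by one: \<open>orbit_abs c (escape c)\<close> is \<open>|r_n(c)|\<close> for
  \<open>n = Suc (escape c)\<close>.\<close>

definition escape :: "real \<Rightarrow> nat" where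
  "escape c = (LEAST n. orbit_abs c n \<ge> 1000)"

lemma escape_ge:
  assumes "c < -2" shows "orbit_abs c (escape c) \<ge> 1000"
proof -
  obtain n where "orbit_abs c n \<ge> 1000"
    using orbit_abs_at_top[OF assms] unfolding filterlim_at_top eventually_sequentially by blast
  then show ?thesis unfolding escape_def by (rule LeastI)
qed

text \<open>One squaring from below 1000 gives at most 10^6. Thus the scale of the escape is bounded
  uniformly in c although its index tends to infinity.\<close>

lemma escape_le:
  assumes "c < -2" "c > -3" shows "orbit_abs c (escape c) \<le> 10 ^ 6"
proof (cases "escape c")
  case 0
  then show ?thesis using orbit_abs_0 assms by simp
next
  case (Suc k)
  then have "orbit_abs c k < 1000"
    unfolding escape_def using not_less_Least[of k "\<lambda>n. orbit_abs c n \<ge> 1000"] by force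
  then have "orbit_abs c k ^ 2 \<le> 1000 ^ 2"
    using orbit_abs_ge[OF assms(1), of k] assms by (intro power_mono) auto
  then show ?thesis using assms by (simp add: Suc orbit_abs_Suc)
qed

lemma escape_at_top: "filterlim escape at_top (at_left (-2))"
  unfolding filterlim_at_top
proof
  fix M
  have "\<forall>\<^sub>F c in at_left (-2). orbit_abs c M < 1000"
    using orbit_abs_tendsto_2 by (rule order_tendstoD) simp
  moreover have "\<forall>\<^sub>F c in at_left (-2). c < (-2::real)"
    by (simp add: eventually_at_filter)
  ultimately show "\<forall>\<^sub>F c in at_left (-2). M \<le> escape c"
  proof eventually_elim
    case (elim c)
    then show ?case
      using escape_ge[of c] orbit_abs_mono[of c "escape c" M] by (cases "M \<le> escape c") auto
  qed
qed

text \<open>For \<open>norm w\<close> at least this large, the factor 20 makes the ratio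
  \<open>norm w / (2 * orbit_abs c k)\<close> of consecutive terms at least 10 up to the escape
  index.\<close>

definition zero_radius :: "real \<Rightarrow> real" where
  "zero_radius c = 20 * orbit_abs c (escape c)"

lemma D_dominant_term:
  assumes "c < -2" "c > -3" "zero_radius c \<le> norm w" "norm w \<le> 3 * zero_radius c"
  shows "norm (D c w - of_real (D_coeff c (Suc (escape c))) * w ^ Suc (escape c))
    \<le> \<bar>D_coeff c (Suc (escape c))\<bar> * norm w ^ Suc (escape c) / 2"
proof -
  define f where "f = (\<lambda>k. of_real (D_coeff c k) * w ^ k)"
  define n where "n = Suc (escape c)"
  define A where "A = orbit_abs c (escape c)"
  have A: "A \<ge> 1000" using escape_ge[OF assms(1)] by (simp add: A_def)
  have pos: "orbit_abs c k > 0" for k using orbit_abs_ge[OF assms(1), of k] assms by simp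
  have step: "norm (f (Suc k)) = norm (f k) * (norm w / (2 * orbit_abs c k))" for k
    by (simp add: f_def norm_mult norm_power abs_D_coeff_Suc)
  have "norm (suminf f - f n) \<le> norm (f n) / 2"
  proof (rule unimodal_series_dominant)
    show "summable (\<lambda>k. norm (f k))" unfolding f_def by (rule summable_D[OF assms(1)])
    fix k assume "k < n"
    then have "orbit_abs c k \<le> A"
      unfolding A_def n_def by (intro orbit_abs_mono assms) auto
    then have "norm w / (2 * orbit_abs c k) \<ge> 10"
      using assms pos[of k] by (simp add: field_simps zero_radius_def A_def)
    then show "10 * norm (f k) \<le> norm (f (Suc k))"
      unfolding step by (subst mult.commute) (rule mult_left_mono, auto)
  next
    fix k assume "k \<ge> n"
    then have "orbit_abs c (Suc (escape c)) \<le> orbit_abs c k"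
      unfolding n_def by (intro orbit_abs_mono assms)
    moreover have "orbit_abs c (Suc (escape c)) = A ^ 2 + c"
      by (simp add: A_def orbit_abs_Suc[OF assms(1)])
    moreover have "A ^ 2 \<ge> 1000 * A" using A by (simp add: power2_eq_square)
    \<comment> \<open>Past the escape index the modulus has been squared. As \<open>norm w\<close>
      is at most 60 * A, the factor 300 brings the ratio of terms down to 1/10.\<close>
    ultimately have "orbit_abs c k \<ge> 300 * A" using assms A by linarith
    then have "norm w / (2 * orbit_abs c k) \<le> 1 / 10"
      using assms pos[of k] by (simp add: field_simps zero_radius_def A_def)
    then show "10 * norm (f (Suc k)) \<le> norm (f k)"
      unfolding step using mult_left_mono[of "norm w / (2 * orbit_abs c k)" "1/10" "norm (f k)"]
      by simp
  qed
  moreover have "suminf f = D c w"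
    unfolding f_def using D_sums[OF assms(1)] by (rule sums_unique[symmetric])
  ultimately show ?thesis by (simp add: f_def n_def norm_mult norm_power)
qed

lemma D_bounds:
  fixes w :: complex
  assumes "c < -2" "c > -3" "zero_radius c \<le> norm w" "norm w \<le> 3 * zero_radius c"
  defines "T \<equiv> \<bar>D_coeff c (Suc (escape c))\<bar> * norm w ^ Suc (escape c)"
  shows "T / 2 \<le> norm (D c w)" "norm (D c w) \<le> 2 * T" "D c w \<noteq> 0"
proof -
  have "norm (of_real (D_coeff c (Suc (escape c))) * w ^ Suc (escape c)) = T"
    by (simp add: T_def norm_mult norm_power)
  then show b: "T / 2 \<le> norm (D c w)" "norm (D c w) \<le> 2 * T"
    using D_dominant_term[OF assms(1-4)] norm_triangle_ineq2[of "D c w" "of_real (D_coeff c (Suc (escape c))) * w ^ Suc (escape c)"]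
      norm_triangle_ineq3[of "D c w" "of_real (D_coeff c (Suc (escape c))) * w ^ Suc (escape c)"]
    unfolding T_def by (simp_all add: abs_le_iff)
  have "norm w > 0" using escape_ge[OF assms(1)] assms(3) unfolding zero_radius_def by linarith
  then have "T > 0" unfolding T_def using abs_D_coeff_pos[OF assms(1)] by simp
  with b show "D c w \<noteq> 0" by auto
qed

subsection \<open>Zeros of functions comparable to a monomial on an annulus\<close>

text \<open>The \<open>LEAST\<close> in \<open>zero_mult\<close> is meaningful only if some
  derivative at z is nonzero; the identity theorem provides one, since f does not vanish
  identically.\<close>

lemma zorder_eq_zero_mult:
  assumes "f holomorphic_on A" "open A" "connected A" "z \<in> A" "w \<in> A" "f w \<noteq> 0"
  shows "zorder f z = int (zero_mult f z)"
proof -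
  have "\<exists>n. (deriv ^^ n) f z \<noteq> 0"
    using holomorphic_fun_eq_0_on_connected[of f A z w] assms by blast
  then have "(deriv ^^ zero_mult f z) f z \<noteq> 0"
    unfolding zero_mult_def by (rule LeastI_ex)
  moreover have "(deriv ^^ i) f z = 0" if "i < zero_mult f z" for i
    using not_less_Least[OF that[unfolded zero_mult_def]] by simp
  ultimately show ?thesis
    by (intro zorder_zero_eqI[OF assms(1,2,4)]) auto
qed

text \<open>The polynomial collecting the zeros has the same zeros in A with the same orders, so the
  quotient extends to a zero-free holomorphic function.\<close>

lemma holomorphic_factor_zeros:
  assumes f: "f holomorphic_on A" "open A" "connected A" "w0 \<in> A" "f w0 \<noteq> 0"
    and Z: "finite Z" "Z = {z \<in> A. f z = 0}"
  obtains G where "G holomorphic_on A" "\<And>w. w \<in> A \<Longrightarrow> G w \<noteq> 0"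
    "\<And>w. w \<in> A \<Longrightarrow> f w = G w * (\<Prod>z\<in>Z. (w - z) ^ zero_mult f z)"
proof -
  define P where "P = (\<lambda>w. \<Prod>z\<in>Z. (w - z) ^ zero_mult f z)"
  have P: "P holomorphic_on B" for B
    unfolding P_def by (intro holomorphic_intros)
  have pos: "zero_mult f z > 0" if "z \<in> Z" for z
  proof (rule ccontr)
    assume "\<not> zero_mult f z > 0"
    then have "zorder f z = 0" using zorder_eq_zero_mult[OF f(1-3) _ f(4,5)] that Z by simp
    moreover have "zorder f z > 0"
    proof (subst zorder_pos_iff[OF f(1,2)])
      show "z \<in> A" "f z = 0" using that Z by auto
      then have "\<forall>\<^sub>F w in at z. f w \<noteq> 0 \<and> w \<in> A"
        by (intro non_zero_neighbour_alt[OF f(1-3) _ f(4,5)])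
      then show "\<exists>\<^sub>F w in at z. f w \<noteq> 0"
        by (intro eventually_frequently) (auto elim: eventually_mono)
    qed
    ultimately show False by simp
  qed
  have zeros: "P z = 0 \<longleftrightarrow> f z = 0" if "z \<in> A" for z
    using that Z pos by (auto simp: P_def prod_zero_iff)
  have ord: "zorder P z = zorder f z" if "z \<in> A" for z
  proof (cases "z \<in> Z")
    case True
    have "zorder P z = int (zero_mult f z)"
    proof (rule zorder_eqI[of UNIV])
      show "(\<lambda>w. \<Prod>y\<in>Z - {z}. (w - y) ^ zero_mult f y) holomorphic_on UNIV"
        by (intro holomorphic_intros)
      show "(\<Prod>y\<in>Z - {z}. (z - y) ^ zero_mult f y) \<noteq> 0"
        using Z(1) by (auto simp: prod_zero_iff)
      show "P w = (\<Prod>y\<in>Z - {z}. (w - y) ^ zero_mult f y) * (w - z) powi int (zero_mult f z)" for w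
        unfolding P_def using prod.remove[OF Z(1) True] by (simp add: mult.commute)
    qed auto
    then show ?thesis using zorder_eq_zero_mult[OF f(1-3) that f(4,5)] by simp
  next
    case False
    then have nz: "f z \<noteq> 0" "P z \<noteq> 0" using that Z zeros by auto
    have "zorder f z = 0"
      by (rule zorder_eq_0I) (use nz f that in \<open>auto simp: analytic_at\<close>)
    moreover have "zorder P z = 0"
      by (rule zorder_eq_0I) (use nz P f that in \<open>auto simp: analytic_at\<close>)
    ultimately show ?thesis by simp
  qed
  obtain h where "h holomorphic_on A" "\<And>z. z \<in> A \<Longrightarrow> h z \<noteq> 0" "\<And>z. z \<in> A \<Longrightarrow> f z = h z * P z"
    by (rule holomorphic_zorder_factorization[OF f(1-3) P zeros ord]) (assumption | rule that)+
  then show ?thesis using that unfolding P_def by blast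
qed

section \<open>Blaschke factors and extremum principles on discs\<close>

lemma norm_blaschke_denominator:
  assumes "norm w = \<rho>" "\<rho> > 0"
  shows "norm ((of_real (\<rho> ^ 2) - cnj z * w) / of_real \<rho>) = norm (w - z)"
proof -
  \<comment> \<open>On the circle \<rho>^2 = w * cnj w; this is why Blaschke factors have modulus
    one there.\<close>
  have "of_real (\<rho> ^ 2) - cnj z * w = w * cnj (w - z)"
    using assms complex_norm_square[of w] by (simp add: algebra_simps)
  then have "norm ((of_real (\<rho> ^ 2) - cnj z * w) / of_real \<rho>) = \<rho> * norm (w - z) / \<rho>"
    using assms by (simp only: norm_divide norm_mult complex_mod_cnj) simp
  then show ?thesis using assms by simp
qed

text \<open>Multiplying \<open>G\<close> by the denominators of the Blaschke factors gives the quotient of \<open>f\<close>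
  by its Blaschke product on the disc of radius \<open>\<rho>\<close>.\<close>

definition blaschke_quotient ::
  "complex set \<Rightarrow> (complex \<Rightarrow> nat) \<Rightarrow> (complex \<Rightarrow> complex) \<Rightarrow> real \<Rightarrow> complex \<Rightarrow> complex" where
  "blaschke_quotient Z m G \<rho> w = G w * (\<Prod>z\<in>Z. ((of_real (\<rho> ^ 2) - cnj z * w) / of_real \<rho>) ^ m z)"

lemma blaschke_quotient_0:
  assumes "\<rho> > 0"
  shows "blaschke_quotient Z m G \<rho> 0 = G 0 * of_real \<rho> ^ (\<Sum>z\<in>Z. m z)"
  using assms by (simp add: blaschke_quotient_def power_sum power2_eq_square)

lemma norm_le_on_disc:
  fixes f :: "complex \<Rightarrow> complex"
  assumes "f holomorphic_on ball 0 r" "\<rho> < r" "norm w \<le> \<rho>"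
    and "\<And>z. norm z = \<rho> \<Longrightarrow> norm (f z) \<le> M"
  shows "norm (f w) \<le> M"
proof (cases "\<rho> = 0")
  case False
  have \<rho>: "\<rho> > 0" using assms(3) False norm_ge_zero[of w] by linarith
  have sub: "cball 0 \<rho> \<subseteq> ball (0::complex) r" using assms(2) by auto
  show ?thesis
  proof (rule maximum_modulus_frontier[of f "cball 0 \<rho>"])
    show "f holomorphic_on interior (cball 0 \<rho>)"
      using assms(1) sub interior_subset holomorphic_on_subset by blast
    show "continuous_on (closure (cball 0 \<rho>)) f"
      using assms(1) sub by (auto intro: holomorphic_on_imp_continuous_on holomorphic_on_subset)
  qed (use assms \<rho> in \<open>auto simp: frontier_cball\<close>)
qed (use assms in auto)

lemma norm_ge_on_disc:
  fixes f :: "complex \<Rightarrow> complex"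
  assumes "f holomorphic_on ball 0 r" "\<rho> < r" "norm w \<le> \<rho>" "M > 0"
    and "\<And>z. norm z < r \<Longrightarrow> f z \<noteq> 0"
    and "\<And>z. norm z = \<rho> \<Longrightarrow> norm (f z) \<ge> M"
  shows "norm (f w) \<ge> M"
proof -
  have "norm (inverse (f w)) \<le> inverse M"
  proof (rule norm_le_on_disc[OF _ assms(2,3)])
    show "(\<lambda>w. inverse (f w)) holomorphic_on ball 0 r"
      using assms by (intro holomorphic_intros) auto
    show "norm (inverse (f z)) \<le> inverse M" if "norm z = \<rho>" for z
      using assms(6)[OF that] assms(4) by (simp add: norm_inverse le_imp_inverse_le)
  qed
  moreover have "f w \<noteq> 0" using assms by auto
  ultimately show ?thesis
    using assms(4) by (simp add: norm_inverse inverse_le_iff_le)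
qed

lemma cnj_mult_neq_square:
  assumes "norm z < \<rho>" "norm w \<le> \<rho>"
  shows "of_real (\<rho> ^ 2) - cnj z * w \<noteq> 0"
proof
  assume "of_real (\<rho> ^ 2) - cnj z * w = 0"
  then have "norm (cnj z * w) = norm (of_real (\<rho> ^ 2) :: complex)" by simp
  then have "norm z * norm w = \<rho> * \<rho>" by (simp add: norm_mult power2_eq_square)
  moreover have "norm z * norm w < \<rho> * \<rho>"
  proof (cases "w = 0")
    case True
    then show ?thesis using assms norm_ge_zero[of z] by (auto intro!: mult_pos_pos simp del: norm_ge_zero)
  next
    case False
    then show ?thesis using assms by (intro mult_less_le_imp_less) auto
  qed
  ultimately show False by simp
qed

context
  fixes f G :: "complex \<Rightarrow> complex" and Z :: "complex set" and m r \<rho>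
  assumes G: "G holomorphic_on ball 0 r"
    and f: "\<And>w. norm w < r \<Longrightarrow> f w = G w * (\<Prod>z\<in>Z. (w - z) ^ m z)"
    and \<rho>: "0 < \<rho>" "\<rho> < r"
begin

lemma norm_blaschke_quotient:
  assumes "norm w = \<rho>" shows "norm (blaschke_quotient Z m G \<rho> w) = norm (f w)"
  using \<rho> assms norm_blaschke_denominator[OF assms \<rho>(1)]
  by (simp add: blaschke_quotient_def f norm_mult prod_norm[symmetric] norm_power)

lemma holomorphic_blaschke_quotient: "blaschke_quotient Z m G \<rho> holomorphic_on ball 0 r"
  unfolding blaschke_quotient_def using \<rho> by (intro holomorphic_intros G) auto

lemma norm_blaschke_quotient_le:
  assumes "\<And>z. norm z = \<rho> \<Longrightarrow> norm (f z) \<le> M" "norm w \<le> \<rho>"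
  shows "norm (blaschke_quotient Z m G \<rho> w) \<le> M"
  using norm_le_on_disc[OF holomorphic_blaschke_quotient \<rho>(2) assms(2)] norm_blaschke_quotient assms(1)
  by simp

lemma norm_blaschke_quotient_ge:
  assumes "\<And>z. norm z = \<rho> \<Longrightarrow> norm (f z) \<ge> M" "norm w \<le> \<rho>" "M > 0"
    and "finite Z" "Z \<subseteq> ball 0 \<rho>" "\<And>z. norm z < r \<Longrightarrow> G z \<noteq> 0"
  shows "norm (blaschke_quotient Z m G \<rho> w) \<ge> M"
proof -
  \<comment> \<open>The minimum principle needs a zero-free function on a disc larger than \<rho>.
    The Blaschke denominators vanish only at the reflections of the nonzero points of
    \<open>Z\<close>; s is the least modulus of such a reflection, capped at r.\<close>
  define s where "s = Min (insert r ((\<lambda>z. \<rho> ^ 2 / norm z) ` (Z - {0})))"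
  have s: "s \<le> r" "\<rho> < s"
  proof -
    show "s \<le> r" unfolding s_def using assms by (intro Min_le) auto
    have "\<rho> < \<rho> ^ 2 / norm z" if "z \<in> Z - {0}" for z
      using that assms(5) \<rho> by (auto simp: field_simps power2_eq_square)
    then show "\<rho> < s" unfolding s_def using assms \<rho> by (subst Min_gr_iff) auto
  qed
  have nz: "blaschke_quotient Z m G \<rho> z \<noteq> 0" if "norm z < s" for z
  proof -
    have "of_real (\<rho> ^ 2) - cnj y * z \<noteq> 0" if y: "y \<in> Z" for y
    proof (cases "y = 0")
      case False
      then have "s \<le> \<rho> ^ 2 / norm y" unfolding s_def using assms y by (intro Min_le) auto
      then have "norm z < \<rho> ^ 2 / norm y" using \<open>norm z < s\<close> by simp
      then have "norm (cnj y * z) < norm (of_real (\<rho> ^ 2) :: complex)"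
        using False by (simp add: norm_mult field_simps norm_power)
      then show ?thesis by force
    qed (use \<rho> in auto)
    then show ?thesis using that s assms \<rho> by (auto simp: blaschke_quotient_def prod_zero_iff)
  qed
  show ?thesis
  proof (rule norm_ge_on_disc[OF _ s(2) assms(2,3) nz])
    show "blaschke_quotient Z m G \<rho> holomorphic_on ball 0 s"
      using s by (intro holomorphic_on_subset[OF holomorphic_blaschke_quotient]) auto
  qed (use assms norm_blaschke_quotient in auto)
qed

end

text \<open>Dividing out the zeros inside the circle by Blaschke factors preserves the modulus on
  it. The maximum principle bounds the quotient at 0, where \<open>f 0 = 1\<close> identifies it
  with the product.\<close>

lemma Jensen_inequality:
  fixes f :: "complex \<Rightarrow> complex"
  assumes f: "f holomorphic_on ball 0 r" "f 0 = 1" and \<rho>: "0 < \<rho>" "\<rho> < r"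
    and Z: "finite {z. norm z < r \<and> f z = 0}"
    and M: "\<And>z. norm z = \<rho> \<Longrightarrow> norm (f z) \<le> M"
  shows "(\<Prod>z | norm z < \<rho> \<and> f z = 0. (\<rho> / norm z) ^ zero_mult f z) \<le> M"
proof -
  define Z where "Z = {z. norm z < r \<and> f z = 0}"
  define Y where "Y = {z. norm z < \<rho> \<and> f z = 0}"
  define m where "m = zero_mult f"
  have Zb: "Z = {z \<in> ball 0 r. f z = 0}" by (auto simp: Z_def)
  have fin: "finite Z" using Z by (simp add: Z_def)
  have YZ: "Y \<subseteq> Z" using \<rho> by (auto simp: Y_def Z_def)
  have finY: "finite Y" using fin YZ finite_subset by blast
  have nz: "0 \<in> ball (0::complex) r" "f 0 \<noteq> 0" using f \<rho> by auto
  obtain G where G: "G holomorphic_on ball 0 r" "\<And>w. w \<in> ball 0 r \<Longrightarrow> G w \<noteq> 0"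
    "\<And>w. w \<in> ball 0 r \<Longrightarrow> f w = G w * (\<Prod>z\<in>Z. (w - z) ^ m z)"
    by (rule holomorphic_factor_zeros[OF f(1) open_ball connected_ball nz fin Zb, folded m_def]) (rule that)
  \<comment> \<open>Zeros of modulus at least \<rho> stay in \<open>H\<close>; only those in
    \<open>Y\<close> are divided out.\<close>
  define H where "H = (\<lambda>w. G w * (\<Prod>z\<in>Z - Y. (w - z) ^ m z))"
  have H: "H holomorphic_on ball 0 r" unfolding H_def by (intro holomorphic_intros G)
  have fH: "f w = H w * (\<Prod>z\<in>Y. (w - z) ^ m z)" if "norm w < r" for w
  proof -
    have "(\<Prod>z\<in>Z. (w - z) ^ m z) = (\<Prod>z\<in>Z - Y. (w - z) ^ m z) * (\<Prod>z\<in>Y. (w - z) ^ m z)"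
      by (rule prod.subset_diff[OF YZ fin])
    then show ?thesis using G(3)[of w] that by (simp only: H_def mult.assoc mem_ball_0)
  qed
  have "norm (blaschke_quotient Y m H \<rho> 0) \<le> M"
    by (rule norm_blaschke_quotient_le[OF H fH \<rho> M]) (use \<rho> in auto)
  then have "norm (H 0) * \<rho> ^ sum m Y \<le> M"
    using \<rho> by (simp add: blaschke_quotient_0 norm_mult norm_power)
  moreover define p where "p = (\<Prod>z\<in>Y. norm z ^ m z)"
  have H0: "norm (H 0) * p = 1"
    using arg_cong[OF fH[of 0], of norm] f \<rho>
    by (simp add: p_def norm_mult prod_norm[symmetric] norm_power)
  then have "p \<noteq> 0" by auto
  with H0 have "norm (H 0) = 1 / p" by (simp add: nonzero_eq_divide_eq)
  ultimately have "\<rho> ^ sum m Y / p \<le> M" by simp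
  moreover have "(\<Prod>z\<in>Y. (\<rho> / norm z) ^ m z) = \<rho> ^ sum m Y / p"
    by (simp add: p_def power_divide prod_dividef power_sum)
  ultimately show ?thesis
    unfolding Y_def[symmetric] m_def[symmetric] by linarith
qed

text \<open>Bounding the derivative through \<open>exp \<circ> L\<close> gives a cheap substitute for the
  Borel--Caratheodory inequality.\<close>

lemma norm_deriv_le_of_bounded_Re:
  assumes L: "L holomorphic_on ball 0 r" and B: "\<And>w. norm w < r \<Longrightarrow> \<bar>Re (L w)\<bar> \<le> B"
    and w: "norm w < r / 2"
  shows "norm (deriv L w) \<le> 2 * exp (2 * B) / r"
proof -
  have r: "r > 0" using w norm_ge_zero[of w] by linarith
  have sub: "cball w (r / 2) \<subseteq> ball 0 r"
  proof
    fix x assume "x \<in> cball w (r / 2)"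
    then have "norm (x - w) \<le> r / 2" by (simp add: dist_norm norm_minus_commute)
    then show "x \<in> ball 0 r" using w norm_triangle_ineq[of w "x - w"] by simp
  qed
  have W: "(\<lambda>x. exp (L x)) holomorphic_on ball 0 r"
    using L by (intro holomorphic_intros)
  have "norm ((deriv ^^ 1) (\<lambda>x. exp (L x)) w) \<le> fact 1 * exp B / (r / 2) ^ 1"
  proof (rule Cauchy_inequality)
    show "(\<lambda>x. exp (L x)) holomorphic_on ball w (r / 2)"
      using sub ball_subset_cball by (intro holomorphic_on_subset[OF W]) blast
    show "continuous_on (cball w (r / 2)) (\<lambda>x. exp (L x))"
      using sub by (intro holomorphic_on_imp_continuous_on holomorphic_on_subset[OF W])
    show "norm (exp (L x)) \<le> exp B" if "norm (w - x) = r / 2" for x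
      using B[of x] sub that by (simp add: norm_exp_eq_Re subset_iff dist_norm abs_le_iff)
  qed (use r in auto)
  moreover have "deriv (\<lambda>x. exp (L x)) w = exp (L w) * deriv L w"
    using L w r by (intro DERIV_imp_deriv) (auto intro!: derivative_eq_intros holomorphic_derivI[OF L])
  ultimately have "exp (Re (L w)) * norm (deriv L w) \<le> 2 * exp B / r"
    by (simp add: norm_mult norm_exp_eq_Re mult.commute)
  moreover have "exp (- B) * norm (deriv L w) \<le> exp (Re (L w)) * norm (deriv L w)"
    using B[of w] w r by (intro mult_right_mono) (auto simp: abs_le_iff)
  ultimately have "exp B * (exp (- B) * norm (deriv L w)) \<le> exp B * (2 * exp B / r)"
    by (intro mult_left_mono) auto
  moreover have "exp B * (exp (- B) * norm (deriv L w)) = norm (deriv L w)"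
    by (simp add: exp_minus)
  moreover have "exp B * (2 * exp B / r) = 2 * exp (2 * B) / r"
    by (simp add: exp_double power2_eq_square)
  ultimately show ?thesis by (simp only:)
qed

section \<open>Power sums through logarithmic derivatives\<close>

lemma power_series_coeff_bound:
  fixes f :: "complex \<Rightarrow> complex"
  assumes s: "\<And>w. norm w < r \<Longrightarrow> (\<lambda>n. s n * w ^ n) sums f w"
    and K: "\<And>w. norm w < r \<Longrightarrow> norm (f w) \<le> K" and \<rho>: "0 < \<rho>" "\<rho> < r"
  shows "norm (s n) \<le> K / \<rho> ^ n"
proof -
  have "f has_fps_expansion Abs_fps s"
  proof (rule has_fps_expansionI)
    have "eventually (\<lambda>u. u \<in> ball 0 r) (nhds (0::complex))"
      using \<rho> by (intro eventually_nhds_in_open) auto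
    then show "\<forall>\<^sub>F u in nhds 0. (\<lambda>n. fps_nth (Abs_fps s) n * u ^ n) sums f u"
      by eventually_elim (use s in auto)
  qed
  then have sn: "s n = (deriv ^^ n) f 0 / fact n"
    using fps_nth_fps_expansion by fastforce
  have f: "f holomorphic_on ball 0 r"
    using s by (intro power_series_holomorphic) auto
  have "norm ((deriv ^^ n) f 0) \<le> fact n * K / \<rho> ^ n"
  proof (rule Cauchy_inequality)
    show "f holomorphic_on ball 0 \<rho>"
      using \<rho> by (intro holomorphic_on_subset[OF f]) auto
    show "continuous_on (cball 0 \<rho>) f"
      using \<rho> by (intro holomorphic_on_imp_continuous_on holomorphic_on_subset[OF f]) auto
  qed (use \<rho> K in auto)
  then show ?thesis by (simp add: sn norm_divide field_simps)
qed


text \<open>The product compares Blaschke denominators for the radii R and 2 * R. Up to conjugation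
  and a nonzero factor, the Taylor coefficients of its logarithmic derivative are the power sums of
  Z; the bound on the log modulus bounds that derivative, and Cauchy's estimates bound the
  coefficients.\<close>

lemma power_sum_bound:
  fixes Z :: "complex set" and m :: "complex \<Rightarrow> nat"
  assumes R: "R > 0" and Z: "Z \<subseteq> ball 0 R"
    and B: "\<And>w. norm w < R \<Longrightarrow>
      \<bar>ln (norm (\<Prod>z\<in>Z. ((1 - cnj z / R ^ 2 * w) / (1 - cnj z / (4 * R ^ 2) * w)) ^ m z))\<bar> \<le> B"
  shows "norm (\<Sum>z\<in>Z. of_nat (m z) * z ^ Suc k) \<le> 8 / 3 * exp (2 * B) * 4 ^ k * R ^ Suc k"
proof -
  define \<alpha> where "\<alpha> = (\<lambda>z. cnj z / R ^ 2)"
  define \<beta> where "\<beta> = (\<lambda>z. cnj z / (4 * R ^ 2))"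
  have \<beta>\<alpha>: "\<beta> z = \<alpha> z / 4" for z by (simp add: \<alpha>_def \<beta>_def)
  have a1: "norm (\<alpha> z * w) < 1" if "z \<in> Z" "norm w < R" for z w
  proof -
    have "norm z < R" using that Z by auto
    then have "norm z * norm w < R * R" using that(2) R by (intro mult_strict_mono) auto
    then show ?thesis using R by (simp add: \<alpha>_def norm_mult norm_divide norm_power power2_eq_square)
  qed
  have b1: "norm (\<beta> z * w) < 1" if "z \<in> Z" "norm w < R" for z w
  proof -
    have "norm (\<beta> z * w) = norm (\<alpha> z * w) / 4" by (simp add: \<beta>\<alpha> norm_mult norm_divide)
    then show ?thesis using a1[OF that] by simp
  qed
  have Re1: "Re (1 - x) > 0" if "norm x < 1" for x :: complex
    using that complex_Re_le_cmod[of x] by simp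
  have nonpos: "1 - x \<notin> \<real>\<^sub>\<le>\<^sub>0" "x \<noteq> 1" if "norm x < 1" for x :: complex
    using Re1[OF that] by (auto simp: complex_nonpos_Reals_iff)
  \<comment> \<open>All 1 - \<alpha> z * w and 1 - \<beta> z * w have positive real part, so
    principal logarithms give a holomorphic logarithm of the product.\<close>
  define L where "L = (\<lambda>w. \<Sum>z\<in>Z. of_nat (m z) * (Ln (1 - \<alpha> z * w) - Ln (1 - \<beta> z * w)))"
  define L' where "L' = (\<lambda>w. \<Sum>z\<in>Z. of_nat (m z) * (- \<alpha> z / (1 - \<alpha> z * w) + \<beta> z / (1 - \<beta> z * w)))"
  have dL: "(L has_field_derivative L' w) (at w)" if "norm w < R" for w
    unfolding L_def L'_def
    using nonpos[OF a1[OF _ that]] nonpos[OF b1[OF _ that]]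
    by (auto intro!: derivative_eq_intros sum.cong simp: divide_inverse mult.commute)
  have holL: "L holomorphic_on ball 0 R"
    using dL by (metis holomorphic_on_open mem_ball_0 open_ball)
  have expL: "exp (L w) = (\<Prod>z\<in>Z. ((1 - \<alpha> z * w) / (1 - \<beta> z * w)) ^ m z)" if "norm w < R" for w
  proof -
    have "exp (L w) = (\<Prod>z\<in>Z. exp (Ln (1 - \<alpha> z * w) - Ln (1 - \<beta> z * w)) ^ m z)"
      unfolding L_def by (cases "finite Z") (simp_all add: exp_sum exp_of_nat_mult)
    also have "\<dots> = (\<Prod>z\<in>Z. ((1 - \<alpha> z * w) / (1 - \<beta> z * w)) ^ m z)"
      using nonpos(2)[OF a1[OF _ that]] nonpos(2)[OF b1[OF _ that]]
      by (intro prod.cong) (auto simp: exp_diff)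
    finally show ?thesis .
  qed
  have ReL: "\<bar>Re (L w)\<bar> \<le> B" if "norm w < R" for w
  proof -
    have "Re (L w) = ln (norm (exp (L w)))" by (simp add: norm_exp_eq_Re)
    then show ?thesis using B[OF that] expL[OF that] by (simp add: \<alpha>_def \<beta>_def)
  qed
  define s where "s = (\<lambda>n. \<Sum>z\<in>Z. of_nat (m z) * (- (\<alpha> z ^ Suc n) + \<beta> z ^ Suc n))"
  have geo: "(\<lambda>n. x ^ Suc n * w ^ n) sums (x / (1 - x * w))" if "norm (x * w) < 1" for x w :: complex
    using sums_mult[OF geometric_sums[OF that], of x] by (simp add: power_mult_distrib mult_ac)
  have sums: "(\<lambda>n. s n * w ^ n) sums L' w" if w: "norm w < R" for w
  proof -
    have "(\<lambda>n. \<Sum>z\<in>Z. of_nat (m z) * (- (\<alpha> z ^ Suc n * w ^ n) + \<beta> z ^ Suc n * w ^ n)) sums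
      (\<Sum>z\<in>Z. of_nat (m z) * (- (\<alpha> z / (1 - \<alpha> z * w)) + \<beta> z / (1 - \<beta> z * w)))"
      using geo[OF a1[OF _ w]] geo[OF b1[OF _ w]]
      by (intro sums_sum sums_mult sums_add sums_minus)
    moreover have "s n * w ^ n =
      (\<Sum>z\<in>Z. of_nat (m z) * (- (\<alpha> z ^ Suc n * w ^ n) + \<beta> z ^ Suc n * w ^ n))" for n
      unfolding s_def sum_distrib_right by (intro sum.cong) (auto simp: algebra_simps)
    ultimately show ?thesis by (simp add: L'_def)
  qed
  \<comment> \<open>The derivative is bounded on radius R / 2, and Cauchy's estimate is applied on
    the smaller radius R / 4.\<close>
  have "norm (s k) \<le> (2 * exp (2 * B) / R) / (R / 4) ^ k"
  proof (rule power_series_coeff_bound[where r = "R / 2" and f = L'])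
    show "(\<lambda>n. s n * w ^ n) sums L' w" if "norm w < R / 2" for w
      using sums[of w] that R by simp
    show "norm (L' w) \<le> 2 * exp (2 * B) / R" if "norm w < R / 2" for w
      using norm_deriv_le_of_bounded_Re[OF holL ReL that] DERIV_imp_deriv[OF dL[of w]] that R by simp
  qed (use R in auto)
  \<comment> \<open>Since \<beta> z = \<alpha> z / 4, the two contributions cannot cancel: the
    factor 1 - 4^-(k+1) is at least 3/4.\<close>
  moreover have "s k = - of_real (1 - (1 / 4) ^ Suc k) / R ^ (2 * Suc k) * cnj (\<Sum>z\<in>Z. of_nat (m z) * z ^ Suc k)"
  proof -
    have "- (\<alpha> z ^ Suc k) + \<beta> z ^ Suc k = - of_real (1 - (1 / 4) ^ Suc k) / R ^ (2 * Suc k) * cnj z ^ Suc k" for z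
    proof -
      have "\<alpha> z ^ Suc k = cnj z ^ Suc k / R ^ (2 * Suc k)"
        by (simp only: \<alpha>_def power_divide power_mult of_real_power)
      moreover have "\<beta> z ^ Suc k = \<alpha> z ^ Suc k * (1 / 4) ^ Suc k"
        unfolding \<beta>\<alpha> power_mult_distrib[symmetric] by simp
      ultimately show ?thesis by (simp add: algebra_simps diff_divide_distrib)
    qed
    then have "s k = (\<Sum>z\<in>Z. - of_real (1 - (1 / 4) ^ Suc k) / R ^ (2 * Suc k) * (of_nat (m z) * cnj z ^ Suc k))"
      unfolding s_def by (intro sum.cong refl) (simp only: mult.left_commute)
    also have "\<dots> = - of_real (1 - (1 / 4) ^ Suc k) / R ^ (2 * Suc k) * (\<Sum>z\<in>Z. of_nat (m z) * cnj z ^ Suc k)"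
      by (rule sum_distrib_left[symmetric])
    also have "(\<Sum>z\<in>Z. of_nat (m z) * cnj z ^ Suc k) = cnj (\<Sum>z\<in>Z. of_nat (m z) * z ^ Suc k)"
      by simp
    finally show ?thesis .
  qed
  then have "norm (s k) = (1 - (1 / 4) ^ Suc k) / R ^ (2 * Suc k) * norm (\<Sum>z\<in>Z. of_nat (m z) * z ^ Suc k)"
  proof -
    have "(1 / 4 :: real) ^ Suc k \<le> 1" by (intro power_le_one) auto
    then show ?thesis using R \<open>s k = _\<close>
      by (simp only: norm_mult norm_divide norm_minus_cancel norm_of_real complex_mod_cnj norm_power) simp
  qed
  moreover have "3 / 4 \<le> 1 - (1 / 4 :: real) ^ Suc k"
    using power_le_one[of "1/4::real" k] by simp
  then have "3 / 4 / R ^ (2 * Suc k) * norm (\<Sum>z\<in>Z. of_nat (m z) * z ^ Suc k)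
     \<le> (1 - (1 / 4) ^ Suc k) / R ^ (2 * Suc k) * norm (\<Sum>z\<in>Z. of_nat (m z) * z ^ Suc k)"
    using R by (intro mult_right_mono divide_right_mono) auto
  ultimately have "3 / 4 / R ^ (2 * Suc k) * norm (\<Sum>z\<in>Z. of_nat (m z) * z ^ Suc k)
     \<le> (2 * exp (2 * B) / R) / (R / 4) ^ k" by linarith
  then have "4 / 3 * R ^ (2 * Suc k) * (3 / 4 / R ^ (2 * Suc k) * norm (\<Sum>z\<in>Z. of_nat (m z) * z ^ Suc k))
     \<le> 4 / 3 * R ^ (2 * Suc k) * ((2 * exp (2 * B) / R) / (R / 4) ^ k)"
    using R by (intro mult_left_mono) auto
  also have "4 / 3 * R ^ (2 * Suc k) * (3 / 4 / R ^ (2 * Suc k) * norm (\<Sum>z\<in>Z. of_nat (m z) * z ^ Suc k))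
     = norm (\<Sum>z\<in>Z. of_nat (m z) * z ^ Suc k)"
    using R by (simp del: power_Suc mult_Suc_right)
  also have "R ^ (2 * Suc k) = R ^ Suc k * R ^ k * R"
    by (simp add: mult_2 power_add)
  also have "4 / 3 * (R ^ Suc k * R ^ k * R) * ((2 * exp (2 * B) / R) / (R / 4) ^ k)
     = 8 / 3 * exp (2 * B) * 4 ^ k * R ^ Suc k"
    using R by (simp add: power_divide)
  finally show ?thesis .
qed

text \<open>The annulus extends to 3 * R so that it contains the circles of radius R and 2 * R;
  comparing these two radii eliminates the unknown zero-free factor of f.\<close>

locale monomial_annulus =
  fixes f :: "complex \<Rightarrow> complex" and R a :: real and n :: nat
  assumes f: "f holomorphic_on ball 0 (3 * R)" "f 0 = 1" and R: "R > 0" and a: "a > 0"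
    and lower: "\<And>w. R \<le> norm w \<Longrightarrow> norm w < 3 * R \<Longrightarrow> a * norm w ^ n / 2 \<le> norm (f w)"
    and upper: "\<And>w. R \<le> norm w \<Longrightarrow> norm w < 3 * R \<Longrightarrow> norm (f w) \<le> 2 * (a * norm w ^ n)"
begin

definition zeros :: "complex set" where
  "zeros = {z. norm z < R \<and> f z = 0}"

definition count :: nat where
  "count = (\<Sum>z\<in>zeros. zero_mult f z)"

lemma zeros_eq: "zeros = {z \<in> ball 0 (3 * R). f z = 0}"
proof -
  have "norm z < R" if "norm z < 3 * R" "f z = 0" for z
  proof (rule ccontr)
    assume z: "\<not> norm z < R"
    then have "a * norm z ^ n > 0" using R a by (intro mult_pos_pos zero_less_power) auto
    then show False using lower[of z] z that by simp
  qed
  then show ?thesis using R by (auto simp: zeros_def)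
qed

lemma finite_zeros: "finite zeros"
proof (cases "zeros = {}")
  case False
  then obtain z where "norm z < 3 * R" "f z = 0" unfolding zeros_eq by auto
  then have "\<not> f constant_on ball 0 (3 * R)"
    using R f(2) unfolding constant_on_def by (metis mem_ball_0 mult_pos_pos norm_zero zero_less_numeral zero_neq_one)
  then have "finite {z \<in> cball 0 R. f z = 0}"
    using R by (intro holomorphic_compact_finite_zeros[OF f(1)]) auto
  then show ?thesis by (rule finite_subset[rotated]) (auto simp: zeros_def)
qed simp

lemma zeros_subset: "zeros \<subseteq> ball 0 R" "0 \<notin> zeros"
  using f by (auto simp: zeros_def)

text \<open>One zero-free factor \<open>G\<close> serves both radii because all zeros lie inside R.
  The extremum principles carry the bounds inwards from the circles.\<close>

lemma quotient_bounds:
  obtains G where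
    "\<And>\<rho> w. \<rho> = R \<or> \<rho> = 2 * R \<Longrightarrow> norm w \<le> \<rho> \<Longrightarrow>
       a * \<rho> ^ n / 2 \<le> norm (blaschke_quotient zeros (zero_mult f) G \<rho> w) \<and>
       norm (blaschke_quotient zeros (zero_mult f) G \<rho> w) \<le> 2 * (a * \<rho> ^ n)"
    "norm (G 0) * (\<Prod>z\<in>zeros. norm z ^ zero_mult f z) = 1"
proof -
  have nz: "0 \<in> ball (0::complex) (3 * R)" "f 0 \<noteq> 0" using f R by auto
  obtain G where G: "G holomorphic_on ball 0 (3 * R)" "\<And>w. w \<in> ball 0 (3 * R) \<Longrightarrow> G w \<noteq> 0"
    "\<And>w. w \<in> ball 0 (3 * R) \<Longrightarrow> f w = G w * (\<Prod>z\<in>zeros. (w - z) ^ zero_mult f z)"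
    by (rule holomorphic_factor_zeros[OF f(1) open_ball connected_ball nz finite_zeros zeros_eq]) (rule that)
  show ?thesis
  proof (rule that[of G], goal_cases)
    case (1 \<rho> w)
    then have \<rho>: "0 < \<rho>" "\<rho> < 3 * R" "R \<le> \<rho>" using R by auto
    have fG: "f w = G w * (\<Prod>z\<in>zeros. (w - z) ^ zero_mult f z)" if "norm w < 3 * R" for w
      using G(3) that by simp
    have "zeros \<subseteq> ball 0 \<rho>" using zeros_subset \<rho> by auto
    then have "a * \<rho> ^ n / 2 \<le> norm (blaschke_quotient zeros (zero_mult f) G \<rho> w)"
      using G \<rho> 1 a finite_zeros lower
      by (intro norm_blaschke_quotient_ge[OF G(1) fG \<rho>(1,2)]) auto
    moreover have "norm (blaschke_quotient zeros (zero_mult f) G \<rho> w) \<le> 2 * (a * \<rho> ^ n)"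
      using \<rho> 1 upper by (intro norm_blaschke_quotient_le[OF G(1) fG \<rho>(1,2)]) auto
    ultimately show ?case by blast
  next
    case 2
    show ?case
      using arg_cong[OF G(3)[of 0], of norm] f R by (simp add: norm_mult prod_norm[symmetric] norm_power)
  qed
qed

text \<open>Passing from R to 2 * R multiplies the quotient at 0 by 2^count and its bounds by 2^n,
  so 2^count / 2^n lies between 1/4 and 4.\<close>

lemma count_bounds: "count \<le> n + 2" "n \<le> count + 2"
proof -
  obtain G where G: "\<And>\<rho> w. \<rho> = R \<or> \<rho> = 2 * R \<Longrightarrow> norm w \<le> \<rho> \<Longrightarrow>
       a * \<rho> ^ n / 2 \<le> norm (blaschke_quotient zeros (zero_mult f) G \<rho> w) \<and>
       norm (blaschke_quotient zeros (zero_mult f) G \<rho> w) \<le> 2 * (a * \<rho> ^ n)"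
    by (rule quotient_bounds) (rule that)
  have b: "a * \<rho> ^ n / 2 \<le> norm (G 0) * \<rho> ^ count" "norm (G 0) * \<rho> ^ count \<le> 2 * (a * \<rho> ^ n)"
    if "\<rho> = R \<or> \<rho> = 2 * R" for \<rho>
    using G[OF that, of 0] that R by (auto simp: blaschke_quotient_0 norm_mult norm_power count_def)
  define x where "x = norm (G 0) * R ^ count"
  define y where "y = a * R ^ n"
  have y: "y > 0" using a R by (simp add: y_def)
  have xy: "y / 2 \<le> x" "x \<le> 2 * y" "2 ^ n * y / 2 \<le> x * 2 ^ count" "x * 2 ^ count \<le> 2 * (2 ^ n * y)"
    using b[of R] b[of "2 * R"] by (simp_all add: x_def y_def power_mult_distrib mult_ac)
  have "y * 2 ^ count \<le> y * 2 ^ (n + 2)"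
  proof -
    have "y / 2 * 2 ^ count \<le> x * 2 ^ count" using xy by (intro mult_right_mono) auto
    with xy have "y / 2 * 2 ^ count \<le> 2 * (2 ^ n * y)" by linarith
    then show ?thesis by (simp add: power_add mult_ac)
  qed
  then show "count \<le> n + 2" using y by (simp del: power_Suc add_2_eq_Suc')
  have "y * 2 ^ n \<le> y * 2 ^ (count + 2)"
  proof -
    have "x * 2 ^ count \<le> 2 * y * 2 ^ count" using xy by (intro mult_right_mono) auto
    with xy have "2 ^ n * y / 2 \<le> 2 * y * 2 ^ count" by linarith
    then show ?thesis by (simp add: power_add mult_ac)
  qed
  then show "n \<le> count + 2" using y by (simp del: power_Suc add_2_eq_Suc')
qed

text \<open>The lower bound for the quotient at 0, with \<open>G 0\<close> eliminated by
  \<open>f 0 = 1\<close>: a counterpart to Jensen's inequality that keeps the zeros from being large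
  on average.\<close>

lemma prod_zeros_le: "(\<Prod>z\<in>zeros. norm z ^ zero_mult f z) * (a * R ^ n) \<le> 2 * R ^ count"
proof -
  obtain G where G: "\<And>\<rho> w. \<rho> = R \<or> \<rho> = 2 * R \<Longrightarrow> norm w \<le> \<rho> \<Longrightarrow>
       a * \<rho> ^ n / 2 \<le> norm (blaschke_quotient zeros (zero_mult f) G \<rho> w) \<and>
       norm (blaschke_quotient zeros (zero_mult f) G \<rho> w) \<le> 2 * (a * \<rho> ^ n)"
    and G0: "norm (G 0) * (\<Prod>z\<in>zeros. norm z ^ zero_mult f z) = 1"
    by (rule quotient_bounds) (rule that)
  define p where "p = (\<Prod>z\<in>zeros. norm z ^ zero_mult f z)"
  have p: "p \<ge> 0" unfolding p_def by (intro prod_nonneg) auto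
  have "a * R ^ n \<le> 2 * (norm (G 0) * R ^ count)"
    using G[of R 0] R by (auto simp: blaschke_quotient_0 norm_mult norm_power count_def)
  then have "p * (a * R ^ n) \<le> p * (2 * (norm (G 0) * R ^ count))"
    using p by (rule mult_left_mono)
  also have "\<dots> = 2 * R ^ count * (norm (G 0) * p)" by simp
  finally show ?thesis using G0 by (simp add: p_def)
qed

text \<open>The ratio of the two Blaschke quotients is free of \<open>G\<close> and, up to the
  factor 2^count, is the product in \<open>power_sum_bound\<close>. The constant 256 is
  \<open>exp (2 * ln 16)\<close>.\<close>

lemma power_sum_zeros:
  "norm (\<Sum>z\<in>zeros. of_nat (zero_mult f z) * z ^ Suc k) \<le> 8 / 3 * 256 * 4 ^ k * R ^ Suc k"
proof -
  obtain G where G: "\<And>\<rho> w. \<rho> = R \<or> \<rho> = 2 * R \<Longrightarrow> norm w \<le> \<rho> \<Longrightarrow>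
       a * \<rho> ^ n / 2 \<le> norm (blaschke_quotient zeros (zero_mult f) G \<rho> w) \<and>
       norm (blaschke_quotient zeros (zero_mult f) G \<rho> w) \<le> 2 * (a * \<rho> ^ n)"
    by (rule quotient_bounds) (rule that)
  let ?W = "\<lambda>w. \<Prod>z\<in>zeros. ((1 - cnj z / R ^ 2 * w) / (1 - cnj z / (4 * R ^ 2) * w)) ^ zero_mult f z"
  let ?h = "blaschke_quotient zeros (zero_mult f) G"
  have W: "?W w * ?h (2 * R) w = 2 ^ count * ?h R w" if w: "norm w < R" for w
  proof -
    have "((1 - cnj z / R ^ 2 * w) / (1 - cnj z / (4 * R ^ 2) * w)) * ((of_real ((2 * R) ^ 2) - cnj z * w) / of_real (2 * R))
        = 2 * ((of_real (R ^ 2) - cnj z * w) / of_real R)" if "z \<in> zeros" for z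
    proof -
      have "of_real ((2 * R) ^ 2) - cnj z * w \<noteq> 0"
        using that zeros_subset w R by (intro cnj_mult_neq_square) auto
      then have nz: "4 * of_real R ^ 2 - cnj z * w \<noteq> 0" by (simp add: power_mult_distrib)
      have R0: "complex_of_real R \<noteq> 0" using R by simp
      have "1 - cnj z / R ^ 2 * w = (of_real R ^ 2 - cnj z * w) / of_real R ^ 2"
        "1 - cnj z / (4 * R ^ 2) * w = (4 * of_real R ^ 2 - cnj z * w) / (4 * of_real R ^ 2)"
        using R0 by (simp_all add: field_simps)
      then show ?thesis using nz R0 by (simp add: field_simps power2_eq_square)
    qed
    then have "?W w * (\<Prod>z\<in>zeros. ((of_real ((2 * R) ^ 2) - cnj z * w) / of_real (2 * R)) ^ zero_mult f z)
      = (\<Prod>z\<in>zeros. (2 * ((of_real (R ^ 2) - cnj z * w) / of_real R)) ^ zero_mult f z)"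
      unfolding prod.distrib[symmetric] power_mult_distrib[symmetric] by (intro prod.cong) auto
    also have "\<dots> = 2 ^ count * (\<Prod>z\<in>zeros. ((of_real (R ^ 2) - cnj z * w) / of_real R) ^ zero_mult f z)"
      unfolding power_mult_distrib prod.distrib by (simp add: count_def power_sum)
    finally show ?thesis unfolding blaschke_quotient_def by (simp only: mult_ac)
  qed
  \<comment> \<open>Each quotient is within a factor 2 of its monomial value, together 4; replacing
    2^count by 2^n costs another 4.\<close>
  have lnW: "\<bar>ln (norm (?W w))\<bar> \<le> ln 16" if w: "norm w < R" for w
  proof -
    define y where "y = a * R ^ n"
    have y: "y > 0" using a R by (simp add: y_def)
    have "(2::real) ^ count \<le> 2 ^ (n + 2)" "(2::real) ^ n \<le> 2 ^ (count + 2)"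
      using count_bounds by (intro power_increasing; simp)+
    then have c: "(2::real) ^ count \<le> 4 * 2 ^ n" "(2::real) ^ n \<le> 4 * 2 ^ count"
      by (simp_all add: power_add)
    have h: "y / 2 \<le> norm (?h R w)" "norm (?h R w) \<le> 2 * y"
      "2 ^ n * y / 2 \<le> norm (?h (2 * R) w)" "norm (?h (2 * R) w) \<le> 2 * (2 ^ n * y)"
      using G[of R w] G[of "2 * R" w] w R by (simp_all add: y_def power_mult_distrib mult_ac)
    have eq: "norm (?W w) * norm (?h (2 * R) w) = 2 ^ count * norm (?h R w)"
      using arg_cong[OF W[OF w], of norm] by (simp only: norm_mult norm_power norm_numeral)
    define N where "N = norm (?W w)"
    have "N * (2 ^ n * y / 2) \<le> N * norm (?h (2 * R) w)"
      using h by (intro mult_left_mono) (auto simp: N_def)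
    also have "\<dots> \<le> 4 * 2 ^ n * (2 * y)"
      unfolding N_def eq using h c y by (intro mult_mono) auto
    finally have "N * (2 ^ n * y) \<le> 16 * (2 ^ n * y)" by simp
    then have N1: "N \<le> 16" using y by (simp add: mult_le_cancel_right)
    have "2 ^ n / 4 * (y / 2) \<le> 2 ^ count * norm (?h R w)"
      using h c y by (intro mult_mono) auto
    also have "\<dots> \<le> N * (2 * (2 ^ n * y))"
      unfolding eq[symmetric] N_def[symmetric] using h by (intro mult_left_mono) (auto simp: N_def)
    finally have "(1 / 16) * (2 ^ n * y) \<le> N * (2 ^ n * y)" by simp
    then have N2: "1 / 16 \<le> N" using y by (simp add: mult_le_cancel_right)
    have "ln N \<le> ln 16" "ln (1 / 16) \<le> ln N" using N1 N2 by (subst ln_le_cancel_iff; simp)+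
    moreover have "ln (1 / 16 :: real) = - ln 16" by (simp add: ln_div)
    ultimately show ?thesis unfolding N_def by linarith
  qed
  have "exp (2 * ln (16::real)) = 256" by (simp add: exp_double)
  then show ?thesis using power_sum_bound[OF R zeros_subset(1) lnW, of k] by simp
qed

end

subsection \<open>Equidistribution on a circle\<close>

lemma integral_cis_power:
  assumes "n > 0"
  shows "integral {0..2 * pi} (\<lambda>t. (of_real a * cis t) ^ n) = 0"
proof -
  define \<kappa> where "\<kappa> = \<i> * of_nat n"
  have \<kappa>: "\<kappa> \<noteq> 0" using assms by (simp add: \<kappa>_def)
  have exp_\<kappa>: "exp (\<kappa> * of_real t) = cis (real n * t)" for t
    by (simp add: \<kappa>_def cis_conv_exp mult.assoc)
  let ?F = "\<lambda>t. of_real a ^ n * (exp (\<kappa> * of_real t) / \<kappa>)"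
  have "((\<lambda>t. (of_real a * cis t) ^ n) has_integral (?F (2 * pi) - ?F 0)) {0..2 * pi}"
  proof (rule fundamental_theorem_of_calculus)
    fix t :: real
    have "((\<lambda>z. of_real a ^ n * (exp (\<kappa> * z) / \<kappa>)) has_field_derivative
        of_real a ^ n * exp (\<kappa> * of_real t)) (at (of_real t))"
      using \<kappa> by (auto intro!: derivative_eq_intros)
    then have "(?F has_vector_derivative of_real a ^ n * exp (\<kappa> * of_real t)) (at t)"
      by (rule has_vector_derivative_real_field)
    moreover have "(of_real a * cis t) ^ n = of_real a ^ n * exp (\<kappa> * of_real t)"
      by (simp only: power_mult_distrib Complex.DeMoivre exp_\<kappa>)
    ultimately show "(?F has_vector_derivative (of_real a * cis t) ^ n) (at t within {0..2 * pi})"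
      by (simp only: has_vector_derivative_at_within)
  qed simp
  moreover have "exp (\<kappa> * of_real (2 * pi)) = 1"
    unfolding exp_\<kappa> using cis_multiple_2pi[of "real n"] by (simp add: mult.commute)
  ultimately show ?thesis by (simp add: integral_unique)
qed

text \<open>Only the averages of powers of z are assumed to vanish in the limit: the weights are
  real, so conjugate powers follow, and concentration reduces mixed monomials to these.\<close>

locale concentrated_averages =
  fixes F :: "'a filter" and Z :: "'a \<Rightarrow> complex set" and w :: "'a \<Rightarrow> complex \<Rightarrow> real" and a B :: real
  assumes a: "a > 0"
    and fin: "\<forall>\<^sub>F c in F. finite (Z c) \<and> Z c \<subseteq> cball 0 B \<and> (\<forall>z\<in>Z c. w c z \<ge> 0) \<and> (\<Sum>z\<in>Z c. w c z) = 1"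
    and conc: "\<And>\<delta>. \<delta> > 0 \<Longrightarrow> ((\<lambda>c. \<Sum>z | z \<in> Z c \<and> \<delta> \<le> \<bar>norm z - a\<bar>. w c z) \<longlongrightarrow> 0) F"
    and moments: "\<And>k. ((\<lambda>c. \<Sum>z\<in>Z c. of_real (w c z) * z ^ Suc k) \<longlongrightarrow> 0) F"
begin

definition avg :: "(complex \<Rightarrow> complex) \<Rightarrow> 'a \<Rightarrow> complex" where
  "avg q c = (\<Sum>z\<in>Z c. of_real (w c z) * q z)"

definition circle_mean :: "(complex \<Rightarrow> complex) \<Rightarrow> complex" where
  "circle_mean q = integral {0..2 * pi} (\<lambda>t. q (of_real a * cis t)) / of_real (2 * pi)"

definition equidistributed :: "(complex \<Rightarrow> complex) \<Rightarrow> bool" where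
  "equidistributed q \<longleftrightarrow> continuous_on UNIV q \<and> (avg q \<longlongrightarrow> circle_mean q) F"

lemma continuous_on_circle:
  fixes q :: "complex \<Rightarrow> 'b :: topological_space"
  assumes "continuous_on UNIV q"
  shows "continuous_on A (\<lambda>t. q (of_real a * cis t))"
  by (rule continuous_on_compose2[OF assms]) (auto intro!: continuous_intros)

lemma avg_tendsto_0:
  assumes q: "continuous_on UNIV q" and q0: "\<And>z. norm z = a \<Longrightarrow> q z = 0"
  shows "(avg q \<longlongrightarrow> 0) F"
proof (rule tendstoI)
  fix e :: real assume e: "e > 0"
  have qB: "continuous_on (cball 0 B) q" using q continuous_on_subset by blast
  have "compact (q ` cball 0 B)" using qB by (intro compact_continuous_image) auto
  then obtain M where M: "M > 0" "\<And>z. z \<in> cball 0 B \<Longrightarrow> norm (q z) \<le> M"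
    by (auto dest!: compact_imp_bounded simp: bounded_pos)
  obtain \<delta> where \<delta>: "\<delta> > 0" "\<And>z. z \<in> cball 0 B \<Longrightarrow> \<bar>norm z - a\<bar> < \<delta> \<Longrightarrow> norm (q z) < e / 2"
  proof -
    \<comment> \<open>The points where q is not small form a compact set missing the circle; if
      nonempty, it has positive distance \<delta> from the circle.\<close>
    define S where "S = cball 0 B \<inter> {z. e / 2 \<le> norm (q z)}"
    have "closed {z. e / 2 \<le> norm (q z)}"
      by (intro closed_Collect_le continuous_intros q)
    then have S: "compact S" unfolding S_def by (intro compact_Int_closed) auto
    show ?thesis
    proof (cases "S = {}")
      case True
      then show ?thesis using that[of 1] by (force simp: S_def)
    next
      case False
      have "continuous_on S (\<lambda>z. \<bar>norm z - a\<bar>)" by (intro continuous_intros)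
      then obtain x where x: "x \<in> S" "\<And>z. z \<in> S \<Longrightarrow> \<bar>norm x - a\<bar> \<le> \<bar>norm z - a\<bar>"
        using continuous_attains_inf[OF S False, of "\<lambda>z. \<bar>norm z - a\<bar>"] by blast
      have "norm x \<noteq> a" using x(1) q0[of x] e by (auto simp: S_def)
      then show ?thesis using that[of "\<bar>norm x - a\<bar>"] x(2) by (force simp: S_def)
    qed
  qed
  have "\<forall>\<^sub>F c in F. \<bar>\<Sum>z | z \<in> Z c \<and> \<delta> \<le> \<bar>norm z - a\<bar>. w c z\<bar> < e / (2 * M)"
    using tendstoD[OF conc[OF \<delta>(1)], of "e / (2 * M)"] e M by simp
  with fin show "\<forall>\<^sub>F c in F. dist (avg q c) 0 < e"
  proof eventually_elim
    case (elim c)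
    define far where "far = {z. z \<in> Z c \<and> \<delta> \<le> \<bar>norm z - a\<bar>}"
    have "norm (avg q c) \<le> (\<Sum>z\<in>Z c. w c z * norm (q z))"
      unfolding avg_def using elim by (intro sum_norm_le) (simp add: norm_mult)
    also have "\<dots> \<le> (\<Sum>z\<in>Z c. w c z * (e / 2) + (if z \<in> far then w c z * M else 0))"
    proof (rule sum_mono)
      fix z assume z: "z \<in> Z c"
      then have zB: "z \<in> cball 0 B" and wz: "w c z \<ge> 0" using elim by auto
      show "w c z * norm (q z) \<le> w c z * (e / 2) + (if z \<in> far then w c z * M else 0)"
      proof (cases "z \<in> far")
        case True
        have "w c z * norm (q z) \<le> w c z * M" using M(2)[OF zB] wz by (intro mult_left_mono)
        moreover have "w c z * (e / 2) \<ge> 0" using wz e by simp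
        ultimately show ?thesis using True by simp
      next
        case False
        then have "norm (q z) \<le> e / 2" using \<delta>(2)[OF zB] z by (force simp: far_def)
        then show ?thesis using False wz by (simp only: if_False add_0_right) (rule mult_left_mono)
      qed
    qed
    also have "\<dots> = e / 2 + M * (\<Sum>z\<in>far. w c z)"
    proof -
      have "(\<Sum>z\<in>Z c. if z \<in> far then w c z * M else 0) = (\<Sum>z\<in>far. w c z * M)"
        using elim by (subst sum.If_cases) (auto simp: far_def intro!: sum.cong)
      then have "(\<Sum>z\<in>Z c. w c z * (e / 2) + (if z \<in> far then w c z * M else 0))
          = (\<Sum>z\<in>Z c. w c z) * (e / 2) + (\<Sum>z\<in>far. w c z) * M"
        by (simp only: sum.distrib sum_distrib_right)
      then show ?thesis using elim by (simp only: mult.commute mult_1_right)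
    qed
    also have "\<dots> < e"
    proof -
      have "M * (\<Sum>z\<in>far. w c z) \<le> M * \<bar>\<Sum>z\<in>far. w c z\<bar>" using M by (intro mult_left_mono) auto
      also have "\<dots> < M * (e / (2 * M))" using elim M unfolding far_def by (intro mult_strict_left_mono) auto
      also have "\<dots> = e / 2" using M by simp
      finally show ?thesis by simp
    qed
    finally show ?case by simp
  qed
qed

text \<open>Only values on the circle matter in the limit, which permits replacing
  \<open>z * cnj z\<close> by a^2.\<close>

lemma equidistributed_cong:
  assumes "equidistributed p" "continuous_on UNIV q" "\<And>z. norm z = a \<Longrightarrow> q z = p z"
  shows "equidistributed q"
proof -
  have "(avg (\<lambda>z. q z - p z) \<longlongrightarrow> 0) F"
    using assms by (intro avg_tendsto_0 continuous_intros) (auto simp: equidistributed_def)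
  moreover have "(avg p \<longlongrightarrow> circle_mean p) F" using assms by (simp add: equidistributed_def)
  ultimately have "((\<lambda>c. avg (\<lambda>z. q z - p z) c + avg p c) \<longlongrightarrow> 0 + circle_mean p) F"
    by (rule tendsto_add)
  moreover have "(\<lambda>c. avg (\<lambda>z. q z - p z) c + avg p c) = avg q"
    by (simp add: avg_def fun_eq_iff sum.distrib[symmetric] algebra_simps)
  moreover have "circle_mean q = circle_mean p"
    unfolding circle_mean_def using assms(3) a by (simp add: norm_mult)
  ultimately show ?thesis using assms(2) by (simp add: equidistributed_def)
qed

section \<open>Averages of polynomials in z and its conjugate\<close>

lemma equidistributed_add:
  assumes "equidistributed p" "equidistributed q"
  shows "equidistributed (\<lambda>z. p z + q z)"
proof -
  have "(\<lambda>t. p (of_real a * cis t)) integrable_on {0..2 * pi}" "(\<lambda>t. q (of_real a * cis t)) integrable_on {0..2 * pi}"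
    using assms by (auto intro!: integrable_continuous_real continuous_on_circle simp: equidistributed_def)
  then have "circle_mean (\<lambda>z. p z + q z) = circle_mean p + circle_mean q"
    by (simp add: circle_mean_def integral_add add_divide_distrib)
  moreover have "avg (\<lambda>z. p z + q z) = (\<lambda>c. avg p c + avg q c)"
    by (simp add: avg_def fun_eq_iff sum.distrib[symmetric] algebra_simps)
  ultimately show ?thesis using assms by (auto simp: equidistributed_def intro!: continuous_intros tendsto_intros)
qed

lemma equidistributed_scale:
  assumes "equidistributed p"
  shows "equidistributed (\<lambda>z. x * p z)"
proof -
  have "circle_mean (\<lambda>z. x * p z) = x * circle_mean p"
    by (simp add: circle_mean_def)
  moreover have "avg (\<lambda>z. x * p z) = (\<lambda>c. x * avg p c)"
    by (simp add: avg_def fun_eq_iff sum_distrib_left mult_ac)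
  ultimately show ?thesis using assms by (auto simp: equidistributed_def intro!: continuous_intros tendsto_intros)
qed

lemma equidistributed_cnj:
  assumes "equidistributed p"
  shows "equidistributed (\<lambda>z. cnj (p z))"
proof -
  have "circle_mean (\<lambda>z. cnj (p z)) = cnj (circle_mean p)"
    by (simp add: circle_mean_def integral_cnj)
  moreover have "avg (\<lambda>z. cnj (p z)) = (\<lambda>c. cnj (avg p c))"
    by (simp add: avg_def fun_eq_iff)
  ultimately show ?thesis using assms by (auto simp: equidistributed_def intro!: continuous_intros tendsto_intros)
qed

lemma equidistributed_power: "equidistributed (\<lambda>z. z ^ k)"
proof (cases k)
  case 0
  have "(avg (\<lambda>z. 1) \<longlongrightarrow> 1) F"
    by (rule tendsto_eventually, rule eventually_mono[OF fin])
       (simp add: avg_def of_real_sum[symmetric] del: of_real_sum)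
  moreover have "circle_mean (\<lambda>z. 1) = 1" by (simp add: circle_mean_def scaleR_conv_of_real)
  ultimately show ?thesis using 0 by (simp add: equidistributed_def)
next
  case (Suc j)
  have "circle_mean (\<lambda>z. z ^ k) = 0"
    using integral_cis_power[of k a] Suc by (simp only: circle_mean_def) simp
  moreover have "(avg (\<lambda>z. z ^ k) \<longlongrightarrow> 0) F"
    using moments[of j] unfolding Suc avg_def[abs_def] .
  ultimately show ?thesis by (auto simp: equidistributed_def intro!: continuous_intros)
qed

lemma equidistributed_monomial: "equidistributed (\<lambda>z. z ^ k * cnj z ^ l)"
proof -
  have sq: "z * cnj z = of_real (a ^ 2)" if "norm z = a" for z
    using that complex_norm_square[of z] by simp
  have on_circle: "(z * cnj z) ^ j = of_real (a ^ (2 * j))" if "norm z = a" for z j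
    by (simp only: sq[OF that] power_mult of_real_power)
  show ?thesis
  proof (cases "l \<le> k")
    case True
    then obtain i where k: "k = l + i" using le_Suc_ex by blast
    show ?thesis
    proof (rule equidistributed_cong)
      show "equidistributed (\<lambda>z. of_real (a ^ (2 * l)) * z ^ i)"
        by (intro equidistributed_scale equidistributed_power)
      show "z ^ k * cnj z ^ l = of_real (a ^ (2 * l)) * z ^ i" if "norm z = a" for z
        unfolding on_circle[OF that, symmetric] k power_add power_mult_distrib by (simp only: mult_ac)
    qed (intro continuous_intros)
  next
    case False
    then obtain i where l: "l = k + i" using le_Suc_ex nat_le_linear by blast
    show ?thesis
    proof (rule equidistributed_cong)
      show "equidistributed (\<lambda>z. of_real (a ^ (2 * k)) * cnj (z ^ i))"
        by (intro equidistributed_scale equidistributed_cnj equidistributed_power)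
      show "z ^ k * cnj z ^ l = of_real (a ^ (2 * k)) * cnj (z ^ i)" if "norm z = a" for z
        unfolding on_circle[OF that, symmetric] l power_add power_mult_distrib complex_cnj_power
        by (simp only: mult_ac)
    qed (intro continuous_intros)
  qed
qed

text \<open>Equidistribution is not stable under products, but the class of functions all of whose
  products with monomials equidistribute is stable under multiplication by \<open>z\<close> and \<open>cnj z\<close>,
  and multipliers of that class are stable under products.\<close>

lemma equidistributed_real_polynomial:
  assumes "real_polynomial_function p"
  shows "equidistributed (\<lambda>z. of_real (p z))"
proof -
  define W where "W = (\<lambda>q. \<forall>k l. equidistributed (\<lambda>z. q z * (z ^ k * cnj z ^ l)))"
  have W_add: "W (\<lambda>z. p z + q z)" if "W p" "W q" for p q
    using that equidistributed_add unfolding W_def distrib_right by blast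
  have W_scale: "W (\<lambda>z. x * p z)" if "W p" for p x
    using that equidistributed_scale unfolding W_def mult.assoc by blast
  have W_z: "W (\<lambda>z. z * p z)" if "W p" for p
    unfolding W_def
  proof (intro allI)
    fix k l
    have "equidistributed (\<lambda>z. p z * (z ^ Suc k * cnj z ^ l))" using that unfolding W_def by blast
    then show "equidistributed (\<lambda>z. z * p z * (z ^ k * cnj z ^ l))" by (simp add: mult_ac)
  qed
  have W_cnj: "W (\<lambda>z. cnj z * p z)" if "W p" for p
    unfolding W_def
  proof (intro allI)
    fix k l
    have "equidistributed (\<lambda>z. p z * (z ^ k * cnj z ^ Suc l))" using that unfolding W_def by blast
    then show "equidistributed (\<lambda>z. cnj z * p z * (z ^ k * cnj z ^ l))" by (simp add: mult_ac)
  qed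
  \<comment> \<open>With q arbitrary, the product case is two successive uses of the induction
    hypotheses.\<close>
  have "W q \<Longrightarrow> W (\<lambda>z. of_real (p z) * q z)" for q
    using assms
  proof (induction p arbitrary: q)
    case (linear f)
    \<comment> \<open>A real-linear functional is f 1 * Re z + f \<i> * Im z; x and y come from
      expressing Re z and Im z by z and cnj z.\<close>
    define x where "x = (of_real (f 1) - \<i> * of_real (f \<i>)) / 2"
    define y where "y = (of_real (f 1) + \<i> * of_real (f \<i>)) / 2"
    have "of_real (f z) = x * z + y * cnj z" for z
    proof -
      interpret f: bounded_linear f by (rule linear(1))
      have "f z = f (Re z *\<^sub>R 1 + Im z *\<^sub>R \<i>)"
        by (rule arg_cong[of _ _ f]) (simp add: complex_eq_iff)
      then have "f z = Re z * f 1 + Im z * f \<i>"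
        by (simp only: f.add f.scaleR real_scaleR_def)
      then show ?thesis by (simp add: x_def y_def complex_eq_iff field_simps)
    qed
    then have "(\<lambda>z. of_real (f z) * q z) = (\<lambda>z. x * (z * q z) + y * (cnj z * q z))"
      by (simp add: fun_eq_iff algebra_simps)
    then show ?case using W_add W_scale W_z W_cnj linear by simp
  next
    case (add f g)
    then show ?case using W_add by (simp add: distrib_right)
  next
    case (mult f g)
    then show ?case by (simp add: mult.assoc)
  qed (rule W_scale)
  moreover have "W (\<lambda>z. 1)" using equidistributed_monomial by (simp add: W_def)
  ultimately have "W (\<lambda>z. of_real (p z) * 1)" by blast
  then have "equidistributed (\<lambda>z. of_real (p z) * 1 * (z ^ 0 * cnj z ^ 0))"
    unfolding W_def by blast
  then show ?thesis by simp
qed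

text \<open>The weights have mass one, so a uniform polynomial approximation within e / 4 moves the
  averages and the circle mean by at most e / 4 each; a third e / 4 covers the convergence for the
  polynomial.\<close>

lemma averages_tendsto:
  fixes g :: "complex \<Rightarrow> real"
  assumes g: "continuous_on UNIV g"
  shows "((\<lambda>c. \<Sum>z\<in>Z c. w c z * g z) \<longlongrightarrow> integral {0..2 * pi} (\<lambda>t. g (of_real a * cis t)) / (2 * pi)) F"
proof (rule tendstoI)
  fix e :: real assume e: "e > 0"
  \<comment> \<open>The disc has to contain the points of the averages and also the limit
    circle.\<close>
  define C where "C = max B a"
  obtain p where p: "real_polynomial_function p" "\<And>z. z \<in> cball 0 C \<Longrightarrow> \<bar>g z - p z\<bar> < e / 4"
    using Stone_Weierstrass_real_polynomial_function[of "cball 0 C" g "e / 4"] e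
      continuous_on_subset[OF g] by auto
  have eq: "equidistributed (\<lambda>z. of_real (p z))" by (rule equidistributed_real_polynomial[OF p(1)])
  then have cp: "continuous_on UNIV p"
    using continuous_on_Re[of UNIV "\<lambda>z. of_real (p z)"] by (simp add: equidistributed_def)
  define Ig where "Ig = integral {0..2 * pi} (\<lambda>t. g (of_real a * cis t)) / (2 * pi)"
  define Ip where "Ip = integral {0..2 * pi} (\<lambda>t. p (of_real a * cis t)) / (2 * pi)"
  have intg: "(\<lambda>t. g (of_real a * cis t)) integrable_on {0..2 * pi}"
    and intp: "(\<lambda>t. p (of_real a * cis t)) integrable_on {0..2 * pi}"
    using g cp by (auto intro!: integrable_continuous_real continuous_on_circle)
  have "circle_mean (\<lambda>z. of_real (p z)) = of_real Ip"
    unfolding circle_mean_def Ip_def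
    using integral_linear[OF intp bounded_linear_of_real[where ?'a = complex]] by (simp add: o_def)
  then have "((\<lambda>c. Re (avg (\<lambda>z. of_real (p z)) c)) \<longlongrightarrow> Ip) F"
    using eq tendsto_Re by (force simp: equidistributed_def)
  then have "((\<lambda>c. \<Sum>z\<in>Z c. w c z * p z) \<longlongrightarrow> Ip) F"
    by (simp add: avg_def)
  then have close: "\<forall>\<^sub>F c in F. dist (\<Sum>z\<in>Z c. w c z * p z) Ip < e / 4"
    by (rule tendstoD) (use e in simp)
  have mean: "\<bar>Ig - Ip\<bar> \<le> e / 4"
  proof -
    have "norm (integral {0..2 * pi} (\<lambda>t. g (of_real a * cis t) - p (of_real a * cis t))) \<le> integral {0..2 * pi} (\<lambda>t. e / 4)"
      using p(2) a by (intro integral_norm_bound_integral integrable_diff intg intp)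
        (auto simp: C_def norm_mult less_imp_le)
    then have "\<bar>integral {0..2 * pi} (\<lambda>t. g (of_real a * cis t)) - integral {0..2 * pi} (\<lambda>t. p (of_real a * cis t))\<bar> \<le> 2 * pi * (e / 4)"
      by (simp add: integral_diff[OF intg intp])
    then show ?thesis
      by (simp add: Ig_def Ip_def diff_divide_distrib[symmetric] abs_divide divide_le_eq mult_ac)
  qed
  show "\<forall>\<^sub>F c in F. dist (\<Sum>z\<in>Z c. w c z * g z) (integral {0..2 * pi} (\<lambda>t. g (of_real a * cis t)) / (2 * pi)) < e"
    unfolding Ig_def[symmetric] using close fin
  proof eventually_elim
    case (elim c)
    have "\<bar>(\<Sum>z\<in>Z c. w c z * g z) - (\<Sum>z\<in>Z c. w c z * p z)\<bar> = \<bar>\<Sum>z\<in>Z c. w c z * (g z - p z)\<bar>"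
      by (simp add: sum_subtractf[symmetric] right_diff_distrib)
    also have "\<dots> \<le> (\<Sum>z\<in>Z c. \<bar>w c z * (g z - p z)\<bar>)" by (rule sum_abs)
    also have "\<dots> \<le> (\<Sum>z\<in>Z c. w c z * (e / 4))"
    proof (rule sum_mono)
      fix z assume z: "z \<in> Z c"
      then have "z \<in> cball 0 C" "w c z \<ge> 0" using elim by (auto simp: C_def)
      then show "\<bar>w c z * (g z - p z)\<bar> \<le> w c z * (e / 4)"
        using p(2)[of z] unfolding abs_mult by (intro mult_mono) auto
    qed
    also have "\<dots> = (\<Sum>z\<in>Z c. w c z) * (e / 4)" by (rule sum_distrib_right[symmetric])
    also have "\<dots> = e / 4" using elim by simp
    finally show ?case using elim e mean unfolding dist_real_def by linarith
  qed
qed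

text \<open>The removed points are at distance at least r - a from the circle, so their mass
  vanishes and the remaining mass tends to 1.\<close>

lemma truncated_averages_tendsto:
  fixes g :: "complex \<Rightarrow> real"
  assumes g: "continuous_on UNIV g" and r: "r > a"
  shows "((\<lambda>c. (\<Sum>z | z \<in> Z c \<and> norm z < r. w c z * g z) / (\<Sum>z | z \<in> Z c \<and> norm z < r. w c z))
    \<longlongrightarrow> integral {0..2 * pi} (\<lambda>t. g (of_real a * cis t)) / (2 * pi)) F"
proof -
  define far where "far = (\<lambda>c. \<Sum>z | z \<in> Z c \<and> r - a \<le> \<bar>norm z - a\<bar>. w c z)"
  have far: "(far \<longlongrightarrow> 0) F" unfolding far_def using r by (intro conc) auto
  have trunc: "((\<lambda>c. \<Sum>z | z \<in> Z c \<and> norm z < r. w c z * h z)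
    \<longlongrightarrow> integral {0..2 * pi} (\<lambda>t. h (of_real a * cis t)) / (2 * pi)) F"
    if h: "continuous_on UNIV h" for h :: "complex \<Rightarrow> real"
  proof -
    have "compact (h ` cball 0 B)"
      using h by (intro compact_continuous_image continuous_on_subset[OF h]) auto
    then obtain M where M: "M > 0" "\<And>z. z \<in> cball 0 B \<Longrightarrow> \<bar>h z\<bar> \<le> M"
      by (auto dest!: compact_imp_bounded simp: bounded_pos)
    have "((\<lambda>c. \<Sum>z | z \<in> Z c \<and> \<not> norm z < r. w c z * h z) \<longlongrightarrow> 0) F"
    proof (rule Lim_null_comparison)
      show "((\<lambda>c. far c * M) \<longlongrightarrow> 0) F" using far by (rule tendsto_mult_left_zero)
      show "\<forall>\<^sub>F c in F. norm (\<Sum>z | z \<in> Z c \<and> \<not> norm z < r. w c z * h z) \<le> far c * M"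
        using fin
      proof eventually_elim
        case (elim c)
        have "norm (\<Sum>z | z \<in> Z c \<and> \<not> norm z < r. w c z * h z) \<le> (\<Sum>z | z \<in> Z c \<and> \<not> norm z < r. w c z * M)"
        proof (rule sum_norm_le)
          fix z assume "z \<in> {z. z \<in> Z c \<and> \<not> norm z < r}"
          then have "z \<in> cball 0 B" "w c z \<ge> 0" using elim by auto
          then show "norm (w c z * h z) \<le> w c z * M"
            using M(2)[of z] by (auto simp: abs_mult intro!: mult_mono)
        qed
        also have "\<dots> \<le> (\<Sum>z | z \<in> Z c \<and> r - a \<le> \<bar>norm z - a\<bar>. w c z * M)"
          using elim M by (intro sum_mono2) auto
        finally show ?case by (simp add: far_def sum_distrib_right)
      qed
    qed
    from tendsto_diff[OF averages_tendsto[OF h] this]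
    have "((\<lambda>c. (\<Sum>z\<in>Z c. w c z * h z) - (\<Sum>z | z \<in> Z c \<and> \<not> norm z < r. w c z * h z))
      \<longlongrightarrow> integral {0..2 * pi} (\<lambda>t. h (of_real a * cis t)) / (2 * pi)) F" by simp
    then show ?thesis
    proof (rule Lim_transform_eventually)
      show "\<forall>\<^sub>F c in F. (\<Sum>z\<in>Z c. w c z * h z) - (\<Sum>z | z \<in> Z c \<and> \<not> norm z < r. w c z * h z)
        = (\<Sum>z | z \<in> Z c \<and> norm z < r. w c z * h z)"
        using fin
      proof eventually_elim
        case (elim c)
        have "(\<Sum>z\<in>Z c. w c z * h z) = (\<Sum>z\<in>{z. z \<in> Z c \<and> norm z < r} \<union> {z. z \<in> Z c \<and> \<not> norm z < r}. w c z * h z)"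
          by (rule sum.cong) auto
        also have "\<dots> = (\<Sum>z | z \<in> Z c \<and> norm z < r. w c z * h z) + (\<Sum>z | z \<in> Z c \<and> \<not> norm z < r. w c z * h z)"
          using elim by (intro sum.union_disjoint) auto
        finally show ?case by simp
      qed
    qed
  qed
  have "((\<lambda>c. \<Sum>z | z \<in> Z c \<and> norm z < r. w c z) \<longlongrightarrow> 1) F"
    using trunc[of "\<lambda>_. 1"] by simp
  from tendsto_divide[OF trunc[OF g] this] show ?thesis by simp
qed

end

subsection \<open>The zeros of \<open>D c\<close>\<close>

abbreviation D_zeros :: "real \<Rightarrow> complex set" where
  "D_zeros c \<equiv> monomial_annulus.zeros (D c) (zero_radius c)"

abbreviation D_count :: "real \<Rightarrow> nat" where
  "D_count c \<equiv> monomial_annulus.count (D c) (zero_radius c)"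

lemma zero_radius_bounds:
  assumes "-3 < c" "c < -2" shows "20000 \<le> zero_radius c" "zero_radius c \<le> 2 * 10 ^ 7"
  using escape_ge[of c] escape_le[of c] assms by (simp_all add: zero_radius_def)

lemma monomial_annulus_D:
  assumes "-3 < c" "c < -2"
  shows "monomial_annulus (D c) (zero_radius c) \<bar>D_coeff c (Suc (escape c))\<bar> (Suc (escape c))"
proof
  show "D c holomorphic_on ball 0 (3 * zero_radius c)" "D c 0 = 1" "0 < \<bar>D_coeff c (Suc (escape c))\<bar>"
    using assms abs_D_coeff_pos[OF assms(2)] by (simp_all only: D_holomorphic D_0)
  show "0 < zero_radius c" using zero_radius_bounds[OF assms] by simp
qed (use assms D_bounds(1,2) in auto)

text \<open>Take logarithms in \<open>prod_zeros_le\<close> and insert the lower bound for the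
  coefficient. The powers of 4 normalize the moduli and the powers of R nearly cancel, as the count
  differs from n by at most 2. What is left involves only A and R, both bounded uniformly in
  c.\<close>

lemma sum_ln_zeros_le:
  assumes c: "-3 < c" "c < -2"
  shows "(\<Sum>z\<in>D_zeros c. zero_mult (D c) z * ln (norm z / 4)) \<le> 2 * 10 ^ 7"
proof -
  interpret monomial_annulus "D c" "zero_radius c" "\<bar>D_coeff c (Suc (escape c))\<bar>" "Suc (escape c)"
    by (rule monomial_annulus_D[OF c])
  define A where "A = orbit_abs c (escape c)"
  define n where "n = Suc (escape c)"
  define R where "R = zero_radius c"
  have R: "20000 \<le> R" "R \<le> 2 * 10 ^ 7" using zero_radius_bounds[OF c] by (auto simp: R_def)
  define P where "P = (\<Prod>z\<in>zeros. norm z ^ zero_mult (D c) z)"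
  have nz: "z \<noteq> 0" if "z \<in> zeros" for z using that zeros_subset by auto
  have P: "P > 0" unfolding P_def using nz by (intro prod_pos) auto
  have "P * ((exp (- A) / 4 ^ n) * R ^ n) \<le> P * (\<bar>D_coeff c n\<bar> * R ^ n)"
    using abs_D_coeff_ge[OF c(2), of "escape c"] P R
    by (intro mult_left_mono mult_right_mono) (auto simp: A_def n_def)
  also have "\<dots> \<le> 2 * R ^ count" using prod_zeros_le by (simp only: P_def R_def n_def)
  finally have "ln (P * ((exp (- A) / 4 ^ n) * R ^ n)) \<le> ln (2 * R ^ count)"
    using P R by (subst ln_le_cancel_iff) auto
  then have "ln P - A - n * ln 4 + n * ln R \<le> ln 2 + count * ln R"
    using P R by (simp add: ln_mult ln_div ln_realpow)
  moreover have "ln P = (\<Sum>z\<in>zeros. zero_mult (D c) z * ln (norm z))"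
    unfolding P_def using finite_zeros nz by (simp add: ln_prod ln_realpow)
  moreover have "(\<Sum>z\<in>zeros. zero_mult (D c) z * ln (norm z / 4))
      = (\<Sum>z\<in>zeros. zero_mult (D c) z * ln (norm z)) - count * ln 4"
  proof -
    have "(\<Sum>z\<in>zeros. zero_mult (D c) z * ln (norm z / 4))
        = (\<Sum>z\<in>zeros. zero_mult (D c) z * ln (norm z) - zero_mult (D c) z * ln 4)"
      using nz by (intro sum.cong) (auto simp: ln_div right_diff_distrib)
    then show ?thesis by (simp add: sum_subtractf count_def sum_distrib_right)
  qed
  ultimately have "(\<Sum>z\<in>zeros. zero_mult (D c) z * ln (norm z / 4))
      \<le> ln 2 + A + (real count - real n) * (ln R - ln 4)"
    by (simp add: algebra_simps)
  also have "(real count - real n) * (ln R - ln 4) \<le> 2 * (ln R - ln 4)"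
    using count_bounds R by (intro mult_right_mono) (auto simp: n_def)
  also have "ln R - ln 4 \<le> R / 4"
    using ln_bound[of "R / 4"] R by (simp add: ln_div)
  also have "ln 2 + A + 2 * (R / 4) \<le> 2 * 10 ^ 7"
    using escape_le[of c] c R ln_2_less_1 by (simp add: A_def)
  finally show ?thesis by simp
qed

text \<open>The bound on \<open>D c\<close> blows up at radius 4, so Jensen's inequality is used at
  \<rho> < 4; replacing \<rho> by 4 costs at most \<open>ln (4 / \<rho>)\<close> per zero.\<close>

lemma sum_ln_inner_zeros_le:
  assumes c: "-3 < c" "c < -2" and \<rho>: "0 < \<rho>" "\<rho> < 4"
  shows "(\<Sum>z\<in>D_zeros c. zero_mult (D c) z * max 0 (ln (4 / norm z)))
    \<le> ln (4 / (4 - \<rho>)) + D_count c * ln (4 / \<rho>)"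
proof -
  interpret monomial_annulus "D c" "zero_radius c" "\<bar>D_coeff c (Suc (escape c))\<bar>" "Suc (escape c)"
    by (rule monomial_annulus_D[OF c])
  define m where "m = (\<lambda>z. real (zero_mult (D c) z))"
  define Y where "Y = {z. norm z < \<rho> \<and> D c z = 0}"
  have Y: "Y \<subseteq> zeros" "finite {z. norm z < 4 \<and> D c z = 0}"
    using zero_radius_bounds[OF c] \<rho> finite_zeros
    by (auto simp: Y_def zeros_def elim!: finite_subset[rotated])
  have nz: "z \<noteq> 0" if "z \<in> zeros" for z using that zeros_subset by auto
  have "(\<Prod>z | norm z < \<rho> \<and> D c z = 0. (\<rho> / norm z) ^ zero_mult (D c) z) \<le> 4 / (4 - \<rho>)"
    using norm_D_le[OF c(2)] \<rho> D_0[OF c(2)] D_holomorphic[OF c(2)]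
    by (intro Jensen_inequality[of _ 4] Y) auto
  then have "(\<Prod>z\<in>Y. (\<rho> / norm z) ^ zero_mult (D c) z) \<le> 4 / (4 - \<rho>)" by (simp only: Y_def)
  moreover have "(\<Prod>z\<in>Y. (\<rho> / norm z) ^ zero_mult (D c) z) > 0"
    using nz Y \<rho> by (intro prod_pos) auto
  ultimately have "ln (\<Prod>z\<in>Y. (\<rho> / norm z) ^ zero_mult (D c) z) \<le> ln (4 / (4 - \<rho>))"
    using \<rho> by (subst ln_le_cancel_iff) auto
  moreover have "ln (\<Prod>z\<in>Y. (\<rho> / norm z) ^ zero_mult (D c) z) = (\<Sum>z\<in>Y. m z * ln (\<rho> / norm z))"
  proof -
    have "finite Y" using Y finite_zeros finite_subset by blast
    moreover have "(\<rho> / norm z) ^ zero_mult (D c) z \<noteq> 0" if "z \<in> Y" for z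
      using that nz Y \<rho> by auto
    ultimately have "ln (\<Prod>z\<in>Y. (\<rho> / norm z) ^ zero_mult (D c) z)
        = (\<Sum>z\<in>Y. ln ((\<rho> / norm z) ^ zero_mult (D c) z))"
      by (intro ln_prod)
    also have "\<dots> = (\<Sum>z\<in>Y. m z * ln (\<rho> / norm z))"
      using nz Y \<rho> by (intro sum.cong) (auto simp: ln_realpow m_def)
    finally show ?thesis .
  qed
  ultimately have Yle: "(\<Sum>z\<in>Y. m z * ln (\<rho> / norm z)) \<le> ln (4 / (4 - \<rho>))" by simp
  have "(\<Sum>z\<in>zeros. m z * max 0 (ln (4 / norm z)))
      \<le> (\<Sum>z\<in>zeros. (if z \<in> Y then m z * ln (\<rho> / norm z) else 0) + m z * ln (4 / \<rho>))"
  proof (rule sum_mono)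
    fix z assume z: "z \<in> zeros"
    have split: "ln (4 / norm z) = ln (\<rho> / norm z) + ln (4 / \<rho>)"
      using nz[OF z] \<rho> by (simp add: ln_div)
    have pos: "ln (4 / \<rho>) > 0" using \<rho> by (simp add: ln_gt_zero)
    have "max 0 (ln (4 / norm z)) \<le> (if z \<in> Y then ln (\<rho> / norm z) else 0) + ln (4 / \<rho>)"
    proof (cases "z \<in> Y")
      case True
      then have "ln (\<rho> / norm z) > 0" using nz[OF z] by (intro ln_gt_zero) (auto simp: Y_def)
      then show ?thesis using True split pos by simp
    next
      case False
      then have "norm z \<ge> \<rho>" using z by (auto simp: Y_def zeros_def)
      then have "ln (\<rho> / norm z) \<le> 0" using \<rho> nz[OF z] by (simp add: ln_div)
      then show ?thesis using False split pos by simp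
    qed
    then have "m z * max 0 (ln (4 / norm z)) \<le> m z * ((if z \<in> Y then ln (\<rho> / norm z) else 0) + ln (4 / \<rho>))"
      by (intro mult_left_mono) (auto simp: m_def)
    then show "m z * max 0 (ln (4 / norm z)) \<le> (if z \<in> Y then m z * ln (\<rho> / norm z) else 0) + m z * ln (4 / \<rho>)"
      by (simp add: distrib_left split: if_splits)
  qed
  also have "\<dots> = (\<Sum>z\<in>Y. m z * ln (\<rho> / norm z)) + count * ln (4 / \<rho>)"
  proof -
    have "(\<Sum>z\<in>zeros. if z \<in> Y then m z * ln (\<rho> / norm z) else 0) = (\<Sum>z\<in>Y. m z * ln (\<rho> / norm z))"
      using finite_zeros Y(1) by (simp add: sum.inter_restrict[symmetric] Int_absorb1)
    then show ?thesis by (simp add: sum.distrib count_def m_def sum_distrib_right)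
  qed
  finally show ?thesis using Yle by (simp add: m_def)
qed

lemma eventually_near_minus_2: "\<forall>\<^sub>F c in at_left (-2). -3 < c \<and> c < (-2::real)"
  using eventually_at_left_real[of "-3" "-2::real"] by (simp add: greaterThanLessThan_iff)

lemma D_count_at_top: "filterlim (\<lambda>c. real (D_count c)) at_top (at_left (-2))"
proof (rule filterlim_at_top_mono)
  have "filterlim (\<lambda>c. real (escape c)) at_top (at_left (-2))"
    using escape_at_top by (rule filterlim_compose[OF filterlim_real_sequentially])
  then show "filterlim (\<lambda>c. -1 + real (escape c)) at_top (at_left (-2))"
    by (rule filterlim_tendsto_add_at_top[OF tendsto_const])
  show "\<forall>\<^sub>F c in at_left (-2). -1 + real (escape c) \<le> real (D_count c)"
    using eventually_near_minus_2
  proof eventually_elim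
    case (elim c)
    interpret monomial_annulus "D c" "zero_radius c" "\<bar>D_coeff c (Suc (escape c))\<bar>" "Suc (escape c)"
      using monomial_annulus_D elim by blast
    show ?case using count_bounds(2) by linarith
  qed
qed

text \<open>As |x| = x + 2 max(0, -x), an upper bound on the signed sum and control of the zeros
  inside the circle suffice.\<close>

lemma mean_ln_deviation_tendsto_0:
  "((\<lambda>c. (\<Sum>z\<in>D_zeros c. zero_mult (D c) z * \<bar>ln (norm z / 4)\<bar>) / D_count c) \<longlongrightarrow> 0) (at_left (-2))"
proof (rule tendstoI)
  fix e :: real assume e: "e > 0"
  \<comment> \<open>Chosen so that \<open>ln (4 / \<rho>) = e / 4\<close>, which after doubling uses
    up half of \<open>count * e\<close>; the other half exceeds \<open>K\<close> once the count
    exceeds 2 * K / e.\<close>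
  define \<rho> where "\<rho> = 4 * exp (- (e / 4))"
  have \<rho>: "0 < \<rho>" "\<rho> < 4" using e by (auto simp: \<rho>_def)
  have ln\<rho>: "ln (4 / \<rho>) = e / 4" by (simp add: \<rho>_def ln_div ln_mult)
  define K where "K = 2 * 10 ^ 7 + 2 * ln (4 / (4 - \<rho>))"
  have "\<forall>\<^sub>F c in at_left (-2). real (D_count c) > max 0 (2 * K / e)"
    using D_count_at_top by (simp only: filterlim_at_top_dense)
  then show "\<forall>\<^sub>F c in at_left (-2). dist ((\<Sum>z\<in>D_zeros c. zero_mult (D c) z * \<bar>ln (norm z / 4)\<bar>) / D_count c) 0 < e"
    using eventually_near_minus_2
  proof eventually_elim
    case (elim c)
    interpret monomial_annulus "D c" "zero_radius c" "\<bar>D_coeff c (Suc (escape c))\<bar>" "Suc (escape c)"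
      using monomial_annulus_D elim by blast
    define S where "S = (\<Sum>z\<in>zeros. zero_mult (D c) z * \<bar>ln (norm z / 4)\<bar>)"
    have S0: "S \<ge> 0" unfolding S_def by (intro sum_nonneg) auto
    have "S = (\<Sum>z\<in>zeros. zero_mult (D c) z * ln (norm z / 4) + 2 * (zero_mult (D c) z * max 0 (ln (4 / norm z))))"
      unfolding S_def
    proof (rule sum.cong)
      fix z assume "z \<in> zeros"
      then have "ln (4 / norm z) = - ln (norm z / 4)" using zeros_subset by (auto simp: ln_div)
      then have "\<bar>ln (norm z / 4)\<bar> = ln (norm z / 4) + 2 * max 0 (ln (4 / norm z))" by auto
      then show "zero_mult (D c) z * \<bar>ln (norm z / 4)\<bar>
          = zero_mult (D c) z * ln (norm z / 4) + 2 * (zero_mult (D c) z * max 0 (ln (4 / norm z)))"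
        by (simp only: distrib_left mult.left_commute)
    qed simp
    also have "\<dots> = (\<Sum>z\<in>zeros. zero_mult (D c) z * ln (norm z / 4))
        + 2 * (\<Sum>z\<in>zeros. zero_mult (D c) z * max 0 (ln (4 / norm z)))"
      by (simp only: sum.distrib sum_distrib_left)
    also have "\<dots> \<le> 2 * 10 ^ 7 + 2 * (ln (4 / (4 - \<rho>)) + count * ln (4 / \<rho>))"
      using elim \<rho> by (intro add_mono mult_left_mono sum_ln_zeros_le sum_ln_inner_zeros_le) auto
    also have "\<dots> = K + count * (e / 2)" by (simp add: K_def ln\<rho>)
    also have "\<dots> < count * e" using elim e by (simp add: field_simps)
    finally have "S / count < e" using elim e by (simp add: field_simps)
    then show ?case using S0 by (simp add: S_def[symmetric])
  qed
qed

lemma abs_ln_bounded_away: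
  assumes "a > 0" "\<delta> > 0"
  obtains \<eta> :: real where "\<eta> > 0" "\<And>t. t > 0 \<Longrightarrow> \<delta> \<le> \<bar>t - a\<bar> \<Longrightarrow> \<eta> \<le> \<bar>ln (t / a)\<bar>"
proof -
  \<comment> \<open>By monotonicity of ln the endpoints a + \<delta> and a - \<delta> decide; the
    latter is relevant only for \<delta> < a, and 1 is a dummy value otherwise.\<close>
  define \<eta> where "\<eta> = min (ln ((a + \<delta>) / a)) (if \<delta> < a then - ln ((a - \<delta>) / a) else 1)"
  show ?thesis
  proof (rule that)
    show "\<eta> > 0" using assms by (auto simp: \<eta>_def ln_div)
    fix t assume t: "t > 0" "\<delta> \<le> \<bar>t - a\<bar>"
    show "\<eta> \<le> \<bar>ln (t / a)\<bar>"
    proof (cases "t \<ge> a")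
      case True
      then have "ln ((a + \<delta>) / a) \<le> ln (t / a)" using t assms by (subst ln_le_cancel_iff) (auto simp: divide_right_mono)
      moreover have "\<eta> \<le> ln ((a + \<delta>) / a)" by (simp add: \<eta>_def)
      ultimately show ?thesis by linarith
    next
      case False
      then have "\<delta> < a" "t \<le> a - \<delta>" using t by auto
      then have "ln (t / a) \<le> ln ((a - \<delta>) / a)" using t assms by (subst ln_le_cancel_iff) (auto simp: divide_right_mono)
      moreover have "\<eta> \<le> - ln ((a - \<delta>) / a)" using \<open>\<delta> < a\<close> by (simp add: \<eta>_def)
      ultimately show ?thesis by linarith
    qed
  qed
qed

definition D_weight :: "real \<Rightarrow> complex \<Rightarrow> real" where
  "D_weight c z = zero_mult (D c) z / D_count c"

text \<open>Concentration is Markov's inequality for the mean of |ln (|z| / 4)|. The moments vanish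
  because the power sums stay bounded while the number of zeros tends to infinity.\<close>

lemma concentrated_averages_D: "concentrated_averages (at_left (-2)) D_zeros D_weight 4 (2 * 10 ^ 7)"
proof
  have count_pos: "\<forall>\<^sub>F c in at_left (-2). real (D_count c) > 0"
    using D_count_at_top by (simp only: filterlim_at_top_dense)
  show "\<forall>\<^sub>F c in at_left (-2). finite (D_zeros c) \<and> D_zeros c \<subseteq> cball 0 (2 * 10 ^ 7) \<and>
      (\<forall>z\<in>D_zeros c. 0 \<le> D_weight c z) \<and> (\<Sum>z\<in>D_zeros c. D_weight c z) = 1"
    using count_pos eventually_near_minus_2
  proof eventually_elim
    case (elim c)
    interpret monomial_annulus "D c" "zero_radius c" "\<bar>D_coeff c (Suc (escape c))\<bar>" "Suc (escape c)"
      using monomial_annulus_D elim by blast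
    have "(\<Sum>z\<in>zeros. D_weight c z) = real count / count"
      unfolding D_weight_def sum_divide_distrib[symmetric] by (simp add: count_def)
    moreover have "zeros \<subseteq> cball 0 (2 * 10 ^ 7)"
      using zeros_subset(1) zero_radius_bounds(2)[of c] elim by fastforce
    ultimately show ?case using finite_zeros elim by (auto simp: D_weight_def)
  qed
  show "((\<lambda>c. \<Sum>z | z \<in> D_zeros c \<and> \<delta> \<le> \<bar>norm z - 4\<bar>. D_weight c z) \<longlongrightarrow> 0) (at_left (-2))"
    if \<delta>: "\<delta> > 0" for \<delta>
  proof -
    obtain \<eta> where \<eta>: "\<eta> > 0" "\<And>t. t > 0 \<Longrightarrow> \<delta> \<le> \<bar>t - 4\<bar> \<Longrightarrow> \<eta> \<le> \<bar>ln (t / 4)\<bar>"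
      by (rule abs_ln_bounded_away[of 4 \<delta>]) (use \<delta> in auto)
    show ?thesis
    proof (rule Lim_null_comparison)
      show "((\<lambda>c. (\<Sum>z\<in>D_zeros c. zero_mult (D c) z * \<bar>ln (norm z / 4)\<bar>) / D_count c * inverse \<eta>) \<longlongrightarrow> 0) (at_left (-2))"
        by (rule tendsto_mult_left_zero[OF mean_ln_deviation_tendsto_0])
      show "\<forall>\<^sub>F c in at_left (-2). norm (\<Sum>z | z \<in> D_zeros c \<and> \<delta> \<le> \<bar>norm z - 4\<bar>. D_weight c z)
          \<le> (\<Sum>z\<in>D_zeros c. zero_mult (D c) z * \<bar>ln (norm z / 4)\<bar>) / D_count c * inverse \<eta>"
        using eventually_near_minus_2
      proof eventually_elim
        case (elim c)
        interpret monomial_annulus "D c" "zero_radius c" "\<bar>D_coeff c (Suc (escape c))\<bar>" "Suc (escape c)"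
          using monomial_annulus_D elim by blast
        have "norm (\<Sum>z | z \<in> zeros \<and> \<delta> \<le> \<bar>norm z - 4\<bar>. D_weight c z)
            \<le> (\<Sum>z | z \<in> zeros \<and> \<delta> \<le> \<bar>norm z - 4\<bar>. D_weight c z * \<bar>ln (norm z / 4)\<bar> * inverse \<eta>)"
        proof (rule sum_norm_le)
          fix z assume z: "z \<in> {z. z \<in> zeros \<and> \<delta> \<le> \<bar>norm z - 4\<bar>}"
          then have "z \<noteq> 0" using zeros_subset(2) by auto
          then have "1 \<le> \<bar>ln (norm z / 4)\<bar> * inverse \<eta>"
            using z \<eta> by (simp add: divide_inverse[symmetric])
          then show "norm (D_weight c z) \<le> D_weight c z * \<bar>ln (norm z / 4)\<bar> * inverse \<eta>"
            using mult_left_mono[of 1 "\<bar>ln (norm z / 4)\<bar> * inverse \<eta>" "D_weight c z"]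
            by (simp add: D_weight_def mult.assoc)
        qed
        also have "\<dots> \<le> (\<Sum>z\<in>zeros. D_weight c z * \<bar>ln (norm z / 4)\<bar> * inverse \<eta>)"
          using finite_zeros \<eta>(1) by (intro sum_mono2) (auto simp: D_weight_def)
        also have "\<dots> = (\<Sum>z\<in>zeros. zero_mult (D c) z * \<bar>ln (norm z / 4)\<bar>) / count * inverse \<eta>"
          by (simp add: D_weight_def sum_distrib_right sum_divide_distrib)
        finally show ?case .
      qed
    qed
  qed
  show "((\<lambda>c. \<Sum>z\<in>D_zeros c. of_real (D_weight c z) * z ^ Suc k) \<longlongrightarrow> 0) (at_left (-2))" for k
  proof (rule Lim_null_comparison)
    let ?K = "8 / 3 * 256 * 4 ^ k * (2 * 10 ^ 7) ^ Suc k :: real"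
    show "((\<lambda>c. ?K / D_count c) \<longlongrightarrow> 0) (at_left (-2))"
      by (rule real_tendsto_divide_at_top[OF tendsto_const D_count_at_top])
    show "\<forall>\<^sub>F c in at_left (-2). norm (\<Sum>z\<in>D_zeros c. of_real (D_weight c z) * z ^ Suc k) \<le> ?K / D_count c"
      using eventually_near_minus_2
    proof eventually_elim
      case (elim c)
      interpret monomial_annulus "D c" "zero_radius c" "\<bar>D_coeff c (Suc (escape c))\<bar>" "Suc (escape c)"
        using monomial_annulus_D elim by blast
      have "(\<Sum>z\<in>zeros. of_real (D_weight c z) * z ^ Suc k)
          = (\<Sum>z\<in>zeros. of_nat (zero_mult (D c) z) * z ^ Suc k) / of_nat count"
        by (simp add: D_weight_def sum_divide_distrib)
      then have "norm (\<Sum>z\<in>zeros. of_real (D_weight c z) * z ^ Suc k)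
          = norm (\<Sum>z\<in>zeros. of_nat (zero_mult (D c) z) * z ^ Suc k) / count"
        by (simp only: norm_divide norm_of_nat)
      also have "\<dots> \<le> (8 / 3 * 256 * 4 ^ k * zero_radius c ^ Suc k) / count"
        by (intro divide_right_mono power_sum_zeros) simp
      also have "\<dots> \<le> ?K / count"
        using zero_radius_bounds[of c] elim
        by (intro divide_right_mono mult_left_mono power_mono) auto
      finally show ?case .
    qed
  qed
qed simp

theorem theorem1:
  fixes g :: "complex \<Rightarrow> real"
  assumes "continuous_on UNIV g" and "bounded (range g)"
  shows "((\<lambda>c. mu_integral c g) \<longlongrightarrow>
            integral {0..2*pi} (\<lambda>t. g (4 * cis t)) / (2*pi)) (at_left (-2))"
proof -
  interpret concentrated_averages "at_left (-2)" D_zeros D_weight 4 "2 * 10 ^ 7"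
    by (rule concentrated_averages_D)
  have "((\<lambda>c. (\<Sum>z | z \<in> D_zeros c \<and> norm z < 1000. D_weight c z * g z) /
      (\<Sum>z | z \<in> D_zeros c \<and> norm z < 1000. D_weight c z))
    \<longlongrightarrow> integral {0..2*pi} (\<lambda>t. g (4 * cis t)) / (2*pi)) (at_left (-2))"
    using truncated_averages_tendsto[OF assms(1), of 1000] by simp
  then show ?thesis
  proof (rule Lim_transform_eventually)
    have "\<forall>\<^sub>F c in at_left (-2). real (D_count c) > 0"
      using D_count_at_top by (simp only: filterlim_at_top_dense)
    then show "\<forall>\<^sub>F c in at_left (-2). (\<Sum>z | z \<in> D_zeros c \<and> norm z < 1000. D_weight c z * g z) /
        (\<Sum>z | z \<in> D_zeros c \<and> norm z < 1000. D_weight c z) = mu_integral c g"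
      using eventually_near_minus_2
    proof eventually_elim
      case (elim c)
      interpret monomial_annulus "D c" "zero_radius c" "\<bar>D_coeff c (Suc (escape c))\<bar>" "Suc (escape c)"
        using monomial_annulus_D elim by blast
      \<comment> \<open>Zeros of modulus below 1000 lie within \<open>zero_radius c\<close>, which
        is at least 20000; the common factor 1 / \<open>D_count c\<close> then cancels.\<close>
      have "{z. z \<in> zeros \<and> norm z < 1000} = small_zeros c"
        using zero_radius_bounds(1)[of c] elim by (auto simp: zeros_def small_zeros_def)
      then show ?case using elim
        by (simp add: mu_integral_def D_weight_def sum_divide_distrib[symmetric])
    qed
  qed
qed

end
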